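(* Let $\mathcal U\subset\Omega$ be an open subset of $\Omega$ and let $\delta>0$ be given. If $\nu_\star(\mathcal V_\delta)=0$, then $\nu_\star(\overline{\mathcal U})=0$.
   Context: $\Omega\subset\mathbb R^2$ is a smooth bounded domain. $V:\mathbb R^k\to\mathbb R$ ($k\ge1$) is smooth with $\inf V=0$ and satisfies: (1) the zero set $\Sigma=\{V=0\}$ is finite with at least two elements; (2) $\nabla^2V(\sigma)$ is positive definite at each $\sigma\in\Sigma$; (3) there are constants $\alpha_\infty>0$, $R_\infty>0$ with $y\cdot\nabla V(y)\ge\alpha_\infty|y|^2$ if $|y|>R_\infty$, and $V(y)\to+\infty$ as $|y|\to+\infty$. Set $e_\varepsilon(u)=\varepsilon\frac{|\nabla u|^2}{2}+\frac1\varepsilon V(u)$ and $E_\varepsilon(u)=\int_\Omega e_\varepsilon(u)\,dx$. Let $M_0>0$, let $\varepsilon_n\in(0,1]$ with $\varepsilon_n\to0$, and let $u_{\varepsilon_n}:\Omega\to\mathbb R^k$ be solutions of $-\Delta u_{\varepsilon_n}=-\varepsilon_n^{-2}\nabla_uV(u_{\varepsilon_n})$ in $\Omega$ with $E_{\varepsilon_n}(u_{\varepsilon_n})\le M_0$, such that (after passing to a subsequence) $e_{\varepsilon_n}(u_{\varepsilon_n})\,dx\rightharpoonup\nu_\star$ in the sense of measures on $\Omega$ as $n\to+\infty$. For $\mathcal U\subset\Omega$ and $\delta>0$: $\mathcal U_\delta=\{x\in\Omega:{\rm dist}(x,\mathcal U)\le\delta\}$ and $\mathcal V_\delta=\mathcal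 U_\delta\setminus\mathcal U$. $\overline{\mathcal U}$ denotes the closure of $\mathcal U$.
   Formalization: The closure of U is assumed to lie in Ω: ν⋆ lives on Ω, and if U may touch ∂Ω the claim fails (unit disc, V=(1−y²)²/4, u=tanh(x₁/(√2ε)), U={|x₁|<1/2}∩Ω, δ=1/4: ν⋆(V_δ)=0 but ν⋆(U)>0). *)

theory Defs
  imports "HOL-Analysis.Analysis"
begin

section \<open>Differential operators on Euclidean spaces\<close>

text \<open>
  All operators below are evaluated at points of open sets only, where the Frechet derivative
  \<open>frechet_derivative f (at x)\<close> depends on \<open>f\<close> near \<open>x\<close> only. So a map on an open set \<open>\<Omega>\<close> is
  represented by a total function whose values outside \<open>\<Omega>\<close> are irrelevant.
\<close>

primrec Ck_on ::
  "nat \<Rightarrow> ('a::euclidean_space \<Rightarrow> 'b::real_normed_vector) \<Rightarrow> 'a set \<Rightarrow> bool" where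
  "Ck_on 0 f S \<longleftrightarrow> continuous_on S f"
| "Ck_on (Suc m) f S \<longleftrightarrow>
     (\<forall>x\<in>S. f differentiable (at x)) \<and>
     (\<forall>b\<in>Basis. Ck_on m (\<lambda>x. frechet_derivative f (at x) b) S)"

definition smooth_on ::
  "('a::euclidean_space \<Rightarrow> 'b::real_normed_vector) \<Rightarrow> 'a set \<Rightarrow> bool" where
  "smooth_on f S \<longleftrightarrow> (\<forall>m. Ck_on m f S)"

definition grad :: "('a::euclidean_space \<Rightarrow> real) \<Rightarrow> 'a \<Rightarrow> 'a" where
  "grad f x = (\<Sum>b\<in>Basis. frechet_derivative f (at x) b *\<^sub>R b)"

lemma GDERIV_grad:
  assumes "f differentiable (at x)"
  shows "GDERIV f x :> grad f x"
proof -
  have lin: "linear (frechet_derivative f (at x))"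
    using assms by (rule linear_frechet_derivative)
  have "h \<bullet> grad f x = frechet_derivative f (at x) h" for h
  proof -
    have "frechet_derivative f (at x) h
        = frechet_derivative f (at x) (\<Sum>b\<in>Basis. (h \<bullet> b) *\<^sub>R b)"
      by (simp add: euclidean_representation)
    also have "\<dots> = (\<Sum>b\<in>Basis. (h \<bullet> b) * frechet_derivative f (at x) b)"
      by (simp add: linear_sum[OF lin] linear_cmul[OF lin])
    finally show ?thesis
      by (simp add: grad_def inner_sum_right mult.commute)
  qed
  then show ?thesis
    using assms by (simp add: gderiv_def frechet_derivative_works)
qed

definition laplacian ::
  "('a::euclidean_space \<Rightarrow> 'b::real_normed_vector) \<Rightarrow> 'a \<Rightarrow> 'b" where
  "laplacian u x =
     (\<Sum>b\<in>Basis. frechet_derivative (\<lambda>z. frechet_derivative u (at z) b) (at x) b)"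

text \<open>The squared Euclidean (Frobenius) norm of the Jacobian matrix of \<open>u\<close>.\<close>

definition grad_norm2 ::
  "('a::euclidean_space \<Rightarrow> 'b::real_normed_vector) \<Rightarrow> 'a \<Rightarrow> real" where
  "grad_norm2 u x = (\<Sum>b\<in>Basis. (norm (frechet_derivative u (at x) b))\<^sup>2)"

section \<open>Domains and potentials\<close>

text \<open>
  Smoothness of the boundary is expressed by local defining functions: near each boundary point
  the domain is a strict sublevel set of a smooth function without critical points.
\<close>

definition smooth_bounded_domain :: "'a::euclidean_space set \<Rightarrow> bool" where
  "smooth_bounded_domain \<Omega> \<longleftrightarrow>
     open \<Omega> \<and> connected \<Omega> \<and> bounded \<Omega> \<and> \<Omega> \<noteq> {} \<and>
     (\<forall>p\<in>frontier \<Omega>. \<exists>W (\<rho> :: 'a \<Rightarrow> real).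
        open W \<and> p \<in> W \<and> smooth_on \<rho> W \<and> (\<forall>x\<in>W. grad \<rho> x \<noteq> 0) \<and>
        \<Omega> \<inter> W = {x \<in> W. \<rho> x < 0} \<and> frontier \<Omega> \<inter> W = {x \<in> W. \<rho> x = 0})"

text \<open>
  The condition on \<open>bdd_below\<close> is needed because \<open>Inf\<close> of a set of reals that is not bounded below
  is unspecified. The Hessian of \<open>V\<close> is the derivative of the vector field \<open>grad V\<close>.
\<close>

definition multiwell_potential :: "('b::euclidean_space \<Rightarrow> real) \<Rightarrow> bool" where
  "multiwell_potential V \<longleftrightarrow>
     smooth_on V UNIV \<and>
     bdd_below (range V) \<and> (INF y. V y) = 0 \<and>
     finite {y. V y = 0} \<and> card {y. V y = 0} \<ge> 2 \<and>
     (\<forall>\<sigma>. V \<sigma> = 0 \<longrightarrow> (\<forall>v. v \<noteq> 0 \<longrightarrow> v \<bullet> frechet_derivative (grad V) (at \<sigma>) v > 0)) \<and>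
     (\<exists>\<alpha>>0. \<exists>R>0. \<forall>y. norm y > R \<longrightarrow> y \<bullet> grad V y \<ge> \<alpha> * (norm y)\<^sup>2) \<and>
     filterlim V at_top at_infinity"

section \<open>Energy and solutions\<close>

definition energy_density ::
  "('b::euclidean_space \<Rightarrow> real) \<Rightarrow> real \<Rightarrow> ('a::euclidean_space \<Rightarrow> 'b) \<Rightarrow> 'a \<Rightarrow> real" where
  "energy_density V \<epsilon> u x = \<epsilon> * (grad_norm2 u x / 2) + 1 / \<epsilon> * V (u x)"

text \<open>The energy takes values in \<open>[0, \<infinity>]\<close>, so that a bound on it includes integrability.\<close>

definition energy ::
  "'a::euclidean_space set \<Rightarrow> ('b::euclidean_space \<Rightarrow> real) \<Rightarrow> real \<Rightarrow> ('a \<Rightarrow> 'b) \<Rightarrow> ennreal" where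
  "energy \<Omega> V \<epsilon> u = (\<integral>\<^sup>+x\<in>\<Omega>. ennreal (energy_density V \<epsilon> u x) \<partial>lborel)"

definition energy_measure ::
  "'a::euclidean_space set \<Rightarrow> ('b::euclidean_space \<Rightarrow> real) \<Rightarrow> real \<Rightarrow> ('a \<Rightarrow> 'b) \<Rightarrow> 'a measure" where
  "energy_measure \<Omega> V \<epsilon> u =
     density (restrict_space lborel \<Omega>) (\<lambda>x. ennreal (energy_density V \<epsilon> u x))"

definition solution_on ::
  "'a::euclidean_space set \<Rightarrow> ('b::euclidean_space \<Rightarrow> real) \<Rightarrow> real \<Rightarrow> ('a \<Rightarrow> 'b) \<Rightarrow> bool" where
  "solution_on \<Omega> V \<epsilon> u \<longleftrightarrow>
     Ck_on 2 u \<Omega> \<and> (\<forall>x\<in>\<Omega>. - laplacian u x = - ((1 / \<epsilon>\<^sup>2) *\<^sub>R grad V (u x)))"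

section \<open>Convergence of measures\<close>

text \<open>
  Radon measures on an open set: Borel measures that are finite on compact subsets (regularity is
  then automatic). Their underlying space is \<open>\<Omega>\<close>, not the whole Euclidean space.
\<close>

definition radon_measure_on :: "'a::euclidean_space set \<Rightarrow> 'a measure \<Rightarrow> bool" where
  "radon_measure_on \<Omega> \<nu> \<longleftrightarrow>
     sets \<nu> = sets (restrict_space borel \<Omega>) \<and>
     (\<forall>K. compact K \<and> K \<subseteq> \<Omega> \<longrightarrow> emeasure \<nu> K < \<infinity>)"

definition converges_as_measures_on ::
  "'a::euclidean_space set \<Rightarrow> (nat \<Rightarrow> 'a measure) \<Rightarrow> 'a measure \<Rightarrow> bool" where
  "converges_as_measures_on \<Omega> \<mu> \<nu> \<longleftrightarrow>
     (\<forall>\<phi> :: 'a \<Rightarrow> real.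
        continuous_on UNIV \<phi> \<and> compact (closure {x. \<phi> x \<noteq> 0}) \<and> closure {x. \<phi> x \<noteq> 0} \<subseteq> \<Omega>
        \<longrightarrow> (\<lambda>n. \<integral>x. \<phi> x \<partial>\<mu> n) \<longlonglongrightarrow> (\<integral>x. \<phi> x \<partial>\<nu>))"

section \<open>Neighbourhoods\<close>

text \<open>
  By convention \<open>infdist x {} = 0\<close>, so \<open>nbhd \<Omega> {} \<delta> = \<Omega>\<close> for nonnegative \<open>\<delta>\<close>. These notions are
  meant for nonempty \<open>U \<subseteq> \<Omega>\<close>.
\<close>

definition nbhd :: "'a::metric_space set \<Rightarrow> 'a set \<Rightarrow> real \<Rightarrow> 'a set" where
  "nbhd \<Omega> U \<delta> = {x \<in> \<Omega>. infdist x U \<le> \<delta>}"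

definition collar :: "'a::metric_space set \<Rightarrow> 'a set \<Rightarrow> real \<Rightarrow> 'a set" where
  "collar \<Omega> U \<delta> = nbhd \<Omega> U \<delta> - U"

end

theory Submission
  imports Defs
begin

text \<open>
  Pohozaev's identity, tested with \<open>\<eta>(x) x\<close> for a cutoff \<open>\<eta>\<close> equal to one near \<open>U\<close>, bounds the potential
  energy in \<open>U\<close> by the energy in the collar, which tends to zero. Testing the equation with
  \<open>\<eta> \<nabla>V(u)\<close> then bounds the gradient energy: since \<open>V\<close> is strictly convex near its zeros,
  \<open>\<integral> \<eta> \<epsilon> |\<nabla>u|\<^sup>2\<close> is controlled up to the contribution of the set where \<open>u\<close> is far from the zeros;
  there \<open>|\<nabla>u| \<le> C / \<epsilon>\<close> and \<open>V(u)\<close> is bounded below, so the contribution is at most a multiple of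
  the potential energy. The interior bound on \<open>u\<close> comes from the mean value inequality for a
  subharmonic function of \<open>|u|\<^sup>2\<close> dominated by \<open>V(u)\<close>, the bound on \<open>\<nabla>u\<close> from Brandt's comparison
  argument at scale \<open>\<epsilon>\<close>.
\<close>

section \<open>Directional derivatives\<close>

text \<open>A solution is known to be C^2 and nothing more, and it obeys no boundary condition. So
  every identity is the divergence of a C^1 field cut off inside \<open>\<Omega>\<close>, with at
  most two derivatives falling on \<open>u\<close>. A Bochner identity for |grad u|^2 would cost a
  third derivative; testing with \<eta> grad V(u) puts that derivative on \<open>V\<close> instead,
  and the leftover term |grad V(u)|^2 / \<epsilon>^2 has the favourable sign. Weak convergence only
  sees continuous, compactly supported test functions. Hence all errors caused by derivatives of
  \<eta> are dominated by one fixed continuous weight \<phi> that vanishes on the closure of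
  \<open>U\<close> and lives in the collar: its integral against the limit measure is zero, so the
  energy weighted by \<phi> tends to zero. For this to suffice, the constants may depend on
  \<open>V\<close>, the energy bound and the geometry, but not on the index of the sequence. One
  error term, from the cross term between the derivative of \<eta> and grad V(u), is not an energy;
  it carries a factor \<epsilon> and disappears for that reason.\<close>

abbreviation pd :: "'a::euclidean_space \<Rightarrow> ('a \<Rightarrow> 'b::real_normed_vector) \<Rightarrow> 'a \<Rightarrow> 'b" where
  "pd b f x \<equiv> frechet_derivative f (at x) b"

text \<open>Component j of a divergence involves the derivative along j alone, so differentiability
  along one line is all that integration by parts asks for. The product and sum rules become those
  of one real variable.\<close>

definition has_dd ::
  "('a::real_normed_vector \<Rightarrow> 'b::real_normed_vector) \<Rightarrow> 'b \<Rightarrow> 'a \<Rightarrow> 'a \<Rightarrow> bool" where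
  "has_dd f d b x \<longleftrightarrow> ((\<lambda>t. f (x + t *\<^sub>R b)) has_vector_derivative d) (at 0)"

lemma has_dd_compose:
  assumes "has_dd f d b x" "(g has_derivative g') (at (f x))"
  shows "has_dd (\<lambda>x. g (f x)) (g' d) b x"
proof -
  have "((g \<circ> (\<lambda>t. f (x + t *\<^sub>R b))) has_vector_derivative g' d) (at 0 within UNIV)"
    using assms unfolding has_dd_def
    by (intro vector_derivative_diff_chain_within) (auto intro: has_derivative_at_withinI)
  then show ?thesis by (simp add: has_dd_def o_def)
qed

lemma has_dd_has_derivative:
  assumes "(f has_derivative f') (at x)"
  shows "has_dd f (f' b) b x"
proof -
  have "has_dd (\<lambda>x. x) b b x"
    unfolding has_dd_def by (auto intro!: derivative_eq_intros)
  from has_dd_compose[OF this assms] show ?thesis .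
qed

named_theorems dd_intros

lemma has_dd_eq_rhs: "has_dd f d b x \<Longrightarrow> d = e \<Longrightarrow> has_dd f e b x"
  by simp

lemma has_dd_pd: "f differentiable (at x) \<Longrightarrow> has_dd f (pd b f x) b x"
  by (rule has_dd_has_derivative) (simp add: frechet_derivative_works)

lemma has_dd_const [dd_intros]: "has_dd (\<lambda>x. c) 0 b x"
  unfolding has_dd_def by (auto intro!: derivative_eq_intros)

lemma has_dd_coord [dd_intros]: "has_dd (\<lambda>x. x \<bullet> c) (b \<bullet> c) b x"
  by (rule has_dd_has_derivative[where f' = "\<lambda>y. y \<bullet> c"]) (auto intro!: derivative_eq_intros)

lemma has_dd_add [dd_intros]:
  "has_dd f d b x \<Longrightarrow> has_dd g e b x \<Longrightarrow> has_dd (\<lambda>x. f x + g x) (d + e) b x"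
  unfolding has_dd_def by (auto intro!: derivative_eq_intros)

lemma has_dd_diff [dd_intros]:
  "has_dd f d b x \<Longrightarrow> has_dd g e b x \<Longrightarrow> has_dd (\<lambda>x. f x - g x) (d - e) b x"
  unfolding has_dd_def by (auto intro!: derivative_eq_intros)

lemma has_dd_sum [dd_intros]:
  "(\<And>i. i \<in> I \<Longrightarrow> has_dd (f i) (d i) b x) \<Longrightarrow>
    has_dd (\<lambda>x. \<Sum>i\<in>I. f i x) (\<Sum>i\<in>I. d i) b x"
  unfolding has_dd_def by (auto intro!: has_vector_derivative_sum)

lemma has_dd_mult [dd_intros]:
  fixes f g :: "'a::real_normed_vector \<Rightarrow> real"
  assumes "has_dd f d b x" "has_dd g e b x"
  shows "has_dd (\<lambda>x. f x * g x) (d * g x + f x * e) b x"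
  using has_vector_derivative_mult[OF assms[unfolded has_dd_def]]
  by (simp add: has_dd_def add.commute)

lemma has_dd_inner [dd_intros]:
  assumes "has_dd f d b x" "has_dd g e b x"
  shows "has_dd (\<lambda>x. f x \<bullet> g x) (d \<bullet> g x + f x \<bullet> e) b x"
proof -
  have "((\<lambda>t. f (x + t *\<^sub>R b) \<bullet> g (x + t *\<^sub>R b)) has_derivative
      (\<lambda>s. f (x + 0 *\<^sub>R b) \<bullet> (s *\<^sub>R e) + (s *\<^sub>R d) \<bullet> g (x + 0 *\<^sub>R b))) (at 0)"
    using assms unfolding has_dd_def has_vector_derivative_def by (intro has_derivative_inner)
  then show ?thesis
    unfolding has_dd_def has_vector_derivative_def
    by (rule has_derivative_eq_rhs) (auto simp: algebra_simps)
qed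

lemma has_dd_DERIV:
  fixes f :: "'a::real_normed_vector \<Rightarrow> real"
  assumes "has_dd f d b (x + s *\<^sub>R b)"
  shows "((\<lambda>t. f (x + t *\<^sub>R b)) has_real_derivative d) (at s)"
proof -
  have "((\<lambda>t. f (x + (t + s) *\<^sub>R b)) has_real_derivative d) (at 0)"
    using assms by (simp add: has_dd_def has_real_derivative_iff_has_vector_derivative algebra_simps)
  then show ?thesis
    using DERIV_shift[of "\<lambda>t. f (x + t *\<^sub>R b)" d 0 s] by simp
qed

section \<open>Integration by parts\<close>

text \<open>Translation invariance makes every difference quotient of \<open>f\<close> along b
  integrate to zero. By the mean value theorem such a quotient is a value of \<open>g\<close>, so it
  is bounded by sup |g| on a fixed compact set, and dominated convergence transfers the zero to
  \<open>g\<close>.\<close>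

lemma integral_dd_zero:
  fixes f g :: "'a::euclidean_space \<Rightarrow> real"
  assumes "open \<Omega>" "compact K" "K \<subseteq> \<Omega>"
    and dd: "\<And>x. x \<in> \<Omega> \<Longrightarrow> has_dd f (g x) b x"
    and cf: "continuous_on \<Omega> f" and cg: "continuous_on \<Omega> g"
    and f0: "\<And>x. x \<notin> K \<Longrightarrow> f x = 0" and g0: "\<And>x. x \<notin> K \<Longrightarrow> g x = 0"
  shows "integrable lborel g" "integral\<^sup>L lborel g = 0"
proof -
  have opK: "open (- K)" using \<open>compact K\<close> by (simp add: compact_imp_closed open_Compl)
  \<comment> \<open>Continuity is known on \<open>\<Omega>\<close> and trivial on the open
    complement of K; the two open sets cover the space.\<close>
  have ext: "continuous_on UNIV h"
    if "continuous_on \<Omega> h" "\<And>x. x \<notin> K \<Longrightarrow> h x = 0" for h :: "'a \<Rightarrow> real"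
  proof -
    have "continuous_on (- K) h"
      using that(2) by (subst continuous_on_cong[OF refl, of _ _ "\<lambda>_. 0"]) auto
    then have "continuous_on (\<Omega> \<union> - K) h"
      using that(1) \<open>open \<Omega>\<close> opK by (intro continuous_on_open_Un) auto
    moreover have "\<Omega> \<union> - K = UNIV" using \<open>K \<subseteq> \<Omega>\<close> by auto
    ultimately show ?thesis by simp
  qed
  have cf': "continuous_on UNIV f" and cg': "continuous_on UNIV g"
    using ext cf cg f0 g0 by blast+
  have supp_int: "integrable lborel h"
    if "continuous_on UNIV h" "\<And>x. x \<notin> K \<Longrightarrow> h x = 0" for h :: "'a \<Rightarrow> real"
  proof -
    have "integrable lborel (\<lambda>x. indicator K x *\<^sub>R h x)"
      using \<open>compact K\<close> that(1) by (intro borel_integrable_compact) (auto intro: continuous_on_subset)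
    moreover have "indicator K x *\<^sub>R h x = h x" for x
      using that(2)[of x] by (cases "x \<in> K") simp_all
    ultimately show ?thesis by (simp only:)
  qed
  show "integrable lborel g" using supp_int cg' g0 by blast
  have intf: "integrable lborel f" using supp_int cf' f0 by blast
  have dd': "has_dd f (g x) b x" for x
  proof (cases "x \<in> K")
    case True then show ?thesis using dd \<open>K \<subseteq> \<Omega>\<close> by blast
  next
    case False
    have "((\<lambda>_. 0) has_derivative (\<lambda>_. 0)) (at x)" by simp
    then have "(f has_derivative (\<lambda>_. 0)) (at x)"
      by (rule has_derivative_transform_within_open[OF _ opK]) (use False f0 in auto)
    from has_dd_has_derivative[OF this, of b] show ?thesis using g0[OF False] by simp
  qed
  obtain B where B: "\<And>x. \<bar>g x\<bar> \<le> B" "B \<ge> 0"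
  proof -
    have "bounded (g ` K)"
      using \<open>compact K\<close> cg' by (meson compact_continuous_image compact_imp_bounded continuous_on_subset subset_UNIV)
    then obtain B where "\<And>x. x \<in> K \<Longrightarrow> \<bar>g x\<bar> \<le> B" by (auto simp: bounded_iff)
    then have "\<bar>g x\<bar> \<le> max B 0" for x using g0[of x] by (cases "x \<in> K") fastforce+
    then show ?thesis using that[of "max B 0"] by auto
  qed
  define h :: "nat \<Rightarrow> real" where "h n = inverse (real (Suc n))" for n
  have h: "0 < h n" "h n \<le> 1" for n unfolding h_def by (auto simp: field_simps)
  have h_lim: "filterlim h (at 0) sequentially"
    unfolding filterlim_at using h LIMSEQ_inverse_real_of_nat
    by (auto simp: h_def[abs_def] intro!: always_eventually)
  define F where "F n x = (f (x + h n *\<^sub>R b) - f x) / h n" for n x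
  \<comment> \<open>The points that can reach K by a step t b with t in [0, 1]. Since
    \<open>h n\<close> is at most 1, all difference quotients vanish outside this set.\<close>
  define K' where "K' = (\<lambda>(x, t). x - t *\<^sub>R b) ` (K \<times> {0..1::real})"
  have K': "compact K'" unfolding K'_def using \<open>compact K\<close>
    by (intro compact_continuous_image compact_Times) (auto simp: split_beta intro!: continuous_intros)
  have trans: "integrable lborel (\<lambda>x. f (x + c)) \<and> (\<integral>x. f (x + c) \<partial>lborel) = (\<integral>x. f x \<partial>lborel)" for c
  proof -
    have [measurable]: "f \<in> borel_measurable borel" using cf' by (rule borel_measurable_continuous_onI)
    have *: "distr lborel borel ((+) c) = (lborel :: 'a measure)" by (rule lborel_distr_plus)
    have "integrable (distr lborel borel ((+) c)) f" using intf by (simp add: *)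
    moreover have "integral\<^sup>L (distr lborel borel ((+) c)) f = integral\<^sup>L lborel f" by (simp add: *)
    ultimately show ?thesis by (simp add: integrable_distr_eq integral_distr add.commute)
  qed
  have F0: "integral\<^sup>L lborel (F n) = 0" for n
    unfolding F_def using trans[of "h n *\<^sub>R b"] intf by simp
  have "(\<lambda>n. integral\<^sup>L lborel (F n)) \<longlonglongrightarrow> integral\<^sup>L lborel g"
  proof (rule integral_dominated_convergence[where w = "\<lambda>x. B * indicator K' x"])
    show "g \<in> borel_measurable lborel"
      using cg' borel_measurable_continuous_onI[of g] by simp
    show "F n \<in> borel_measurable lborel" for n
      using borel_measurable_continuous_onI[OF cf'] unfolding F_def by simp
    show "integrable lborel (\<lambda>x. B * indicator K' x)"
      using K' by (auto intro!: integrable_real_indicator emeasure_compact_finite simp: borel_compact)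
    show "AE x in lborel. (\<lambda>n. F n x) \<longlonglongrightarrow> g x"
    proof (rule AE_I2)
      fix x
      have "((\<lambda>t. f (x + t *\<^sub>R b)) has_real_derivative g x) (at 0)"
        using has_dd_DERIV[of f "g x" b x 0] dd'[of x] by simp
      then have "(\<lambda>k. (f (x + k *\<^sub>R b) - f x) / k) \<midarrow>0\<rightarrow> g x" by (simp add: DERIV_def)
      from filterlim_compose[OF this h_lim] show "(\<lambda>n. F n x) \<longlonglongrightarrow> g x"
        by (simp add: F_def)
    qed
    show "AE x in lborel. norm (F n x) \<le> B * indicator K' x" for n
    proof (rule AE_I2)
      fix x
      show "norm (F n x) \<le> B * indicator K' x"
      proof (cases "x \<in> K'")
        case True
        have "\<exists>z. z > 0 \<and> z < h n \<and>
            f (x + h n *\<^sub>R b) - f (x + 0 *\<^sub>R b) = (h n - 0) * g (x + z *\<^sub>R b)"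
          using h[of n] dd' by (intro MVT2[of 0 "h n" "\<lambda>t. f (x + t *\<^sub>R b)"] has_dd_DERIV) auto
        then obtain z where "f (x + h n *\<^sub>R b) - f x = h n * g (x + z *\<^sub>R b)" by auto
        then have "F n x = g (x + z *\<^sub>R b)" using h[of n] by (simp add: F_def)
        then show ?thesis using B True by simp
      next
        case False
        have "y \<in> K'" if "y + t *\<^sub>R b \<in> K" "0 \<le> t" "t \<le> 1" for y t
          unfolding K'_def using that by (auto intro!: image_eqI[where x = "(y + t *\<^sub>R b, t)"])
        from this[of x 0] this[of x "h n"] False h[of n]
        have "x \<notin> K" "x + h n *\<^sub>R b \<notin> K" by fastforce+
        then show ?thesis using B by (simp add: F_def f0)
      qed
    qed
  qed
  then show "integral\<^sup>L lborel g = 0" by (simp add: F0 LIMSEQ_const_iff)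
qed

section \<open>Functions of class \<open>C\<^sup>2\<close>\<close>

lemma Ck_on_2D:
  assumes "Ck_on 2 f S"
  shows "x \<in> S \<Longrightarrow> f differentiable (at x)"
    and "x \<in> S \<Longrightarrow> b \<in> Basis \<Longrightarrow> pd b f differentiable (at x)"
    and "b \<in> Basis \<Longrightarrow> c \<in> Basis \<Longrightarrow> continuous_on S (pd c (pd b f))"
    and "b \<in> Basis \<Longrightarrow> continuous_on S (pd b f)"
    and "continuous_on S f"
  using assms
  by (auto simp: numeral_2_eq_2 intro!: continuous_at_imp_continuous_on
      differentiable_imp_continuous_within)

lemma Ck_on_2I:
  assumes "open S"
    and 1: "\<And>x. x \<in> S \<Longrightarrow> (f has_derivative f' x) (at x)"
    and 2: "\<And>x b. x \<in> S \<Longrightarrow> b \<in> Basis \<Longrightarrow> ((\<lambda>x. f' x b) has_derivative f'' b x) (at x)"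
    and 3: "\<And>b c. b \<in> Basis \<Longrightarrow> c \<in> Basis \<Longrightarrow> continuous_on S (\<lambda>x. f'' b x c)"
  shows "Ck_on 2 f S"
    and "x \<in> S \<Longrightarrow> laplacian f x = (\<Sum>b\<in>Basis. f'' b x b)"
proof -
  have eq1: "frechet_derivative f (at x) = f' x" if "x \<in> S" for x
    using 1[OF that] by (simp add: frechet_derivative_at[symmetric])
  have D2: "(pd b f has_derivative f'' b x) (at x)" if "x \<in> S" "b \<in> Basis" for x b
    using 2[OF that] by (rule has_derivative_transform_within_open[OF _ \<open>open S\<close> \<open>x \<in> S\<close>]) (simp add: eq1)
  then have eq2: "frechet_derivative (pd b f) (at x) = f'' b x" if "x \<in> S" "b \<in> Basis" for x b
    using that by (metis frechet_derivative_at)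
  have "continuous_on S (pd c (pd b f))" if "b \<in> Basis" "c \<in> Basis" for b c
    using 3[OF that] by (rule continuous_on_eq) (simp add: eq2 that)
  then show "Ck_on 2 f S"
    unfolding numeral_2_eq_2 Ck_on.simps using 1 D2 differentiableI by blast
  show "x \<in> S \<Longrightarrow> laplacian f x = (\<Sum>b\<in>Basis. f'' b x b)"
    by (simp add: laplacian_def eq2)
qed

section \<open>Symmetry of second partial derivatives\<close>

text \<open>The mean value theorem is used twice: along b for the increment of \<open>f\<close> by h
  c, then along c for \<open>fb\<close>. The second difference itself is symmetric in b and
  c.\<close>

lemma second_difference_mvt:
  fixes f :: "'a::real_normed_vector \<Rightarrow> real"
  assumes h: "h > 0"
    and S: "\<And>s t. 0 \<le> s \<Longrightarrow> s \<le> h \<Longrightarrow> 0 \<le> t \<Longrightarrow> t \<le> h \<Longrightarrow> x + s *\<^sub>R b + t *\<^sub>R c \<in> S"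
    and 1: "\<And>y. y \<in> S \<Longrightarrow> has_dd f (fb y) b y"
    and 2: "\<And>y. y \<in> S \<Longrightarrow> has_dd fb (fbc y) c y"
  shows "\<exists>s t. 0 \<le> s \<and> s \<le> h \<and> 0 \<le> t \<and> t \<le> h \<and>
    f (x + h *\<^sub>R b + h *\<^sub>R c) - f (x + h *\<^sub>R b) - f (x + h *\<^sub>R c) + f x
      = h * h * fbc (x + s *\<^sub>R b + t *\<^sub>R c)"
proof -
  have "\<exists>s. s > 0 \<and> s < h \<and>
      (f (x + h *\<^sub>R c + h *\<^sub>R b) - f (x + h *\<^sub>R b)) - (f (x + h *\<^sub>R c + 0 *\<^sub>R b) - f (x + 0 *\<^sub>R b))
      = (h - 0) * (fb (x + h *\<^sub>R c + s *\<^sub>R b) - fb (x + s *\<^sub>R b))"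
    using h
  proof (intro MVT2[where f = "\<lambda>s. f (x + h *\<^sub>R c + s *\<^sub>R b) - f (x + s *\<^sub>R b)"] DERIV_diff has_dd_DERIV 1)
    fix s assume "0 \<le> s" "s \<le> h"
    then show "x + h *\<^sub>R c + s *\<^sub>R b \<in> S" "x + s *\<^sub>R b \<in> S"
      using S[of s h] S[of s 0] h by (auto simp: algebra_simps)
  qed
  then obtain s where s: "s > 0" "s < h" and
    e1: "f (x + h *\<^sub>R c + h *\<^sub>R b) - f (x + h *\<^sub>R b) - (f (x + h *\<^sub>R c) - f x)
      = h * (fb (x + h *\<^sub>R c + s *\<^sub>R b) - fb (x + s *\<^sub>R b))" by auto
  have "\<exists>t. t > 0 \<and> t < h \<and>
      fb (x + s *\<^sub>R b + h *\<^sub>R c) - fb (x + s *\<^sub>R b + 0 *\<^sub>R c) = (h - 0) * fbc (x + s *\<^sub>R b + t *\<^sub>R c)"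
    using h s S by (intro MVT2[where f = "\<lambda>t. fb (x + s *\<^sub>R b + t *\<^sub>R c)"] has_dd_DERIV 2) auto
  then obtain t where "t > 0" "t < h"
    "fb (x + s *\<^sub>R b + h *\<^sub>R c) - fb (x + s *\<^sub>R b) = h * fbc (x + s *\<^sub>R b + t *\<^sub>R c)" by auto
  with s e1 show ?thesis
    by (intro exI[of _ s] exI[of _ t]) (auto simp: algebra_simps)
qed

text \<open>Both mixed derivatives are limits of the same second difference divided by h^2,
  evaluated at intermediate points that converge to x.\<close>

lemma mixed_dd_commute:
  fixes f :: "'a::real_normed_vector \<Rightarrow> real"
  assumes "open S" "x \<in> S"
    and 1: "\<And>y. y \<in> S \<Longrightarrow> has_dd f (fb y) b y" "\<And>y. y \<in> S \<Longrightarrow> has_dd f (fc y) c y"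
    and 2: "\<And>y. y \<in> S \<Longrightarrow> has_dd fb (fbc y) c y" "\<And>y. y \<in> S \<Longrightarrow> has_dd fc (fcb y) b y"
    and 3: "continuous_on S fbc" "continuous_on S fcb"
  shows "fbc x = fcb x"
proof -
  obtain r where r: "r > 0" "ball x r \<subseteq> S" using assms(1,2) by (meson openE)
  \<comment> \<open>Small enough that x + s b + t c stays in the ball of radius r for s and t up to
    \<open>h n\<close>; the summand 1 makes the denominator positive and the inequality
    strict.\<close>
  define h where "h n = r / (norm b + norm c + 1) * inverse (real (Suc n))" for n
  have N: "norm b + norm c + 1 > 0" by (smt (verit) norm_ge_zero)
  have h0: "h n > 0" for n using r N by (simp add: h_def)
  have hl: "h \<longlonglongrightarrow> 0"
    unfolding h_def using LIMSEQ_inverse_real_of_nat by (rule tendsto_mult_right_zero)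
  have in_S: "x + s *\<^sub>R b + t *\<^sub>R c \<in> S" if "0 \<le> s" "s \<le> h n" "0 \<le> t" "t \<le> h n" for s t n
  proof -
    have "norm (s *\<^sub>R b + t *\<^sub>R c) \<le> s * norm b + t * norm c"
      using that norm_triangle_ineq[of "s *\<^sub>R b" "t *\<^sub>R c"] by simp
    also have "\<dots> \<le> h n * norm b + h n * norm c"
      using that by (intro add_mono mult_right_mono) auto
    also have "\<dots> < h n * (norm b + norm c + 1)"
      using h0[of n] by (simp add: algebra_simps)
    also have "\<dots> = r * inverse (real (Suc n))" using N by (simp add: h_def)
    also have "\<dots> \<le> r" using r by (simp add: field_simps)
    finally have "dist x (x + (s *\<^sub>R b + t *\<^sub>R c)) < r"
      by (simp only: dist_norm norm_minus_commute[of x] add_diff_cancel_left')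
    then have "dist x (x + s *\<^sub>R b + t *\<^sub>R c) < r" by (simp only: add.assoc)
    then show ?thesis using r by auto
  qed
  have lim: "(\<lambda>n. x + s n *\<^sub>R b + t n *\<^sub>R c) \<longlonglongrightarrow> x"
    if "\<And>n. 0 \<le> s n \<and> s n \<le> h n" "\<And>n. 0 \<le> t n \<and> t n \<le> h n" for s t
  proof -
    have "s \<longlonglongrightarrow> 0" "t \<longlonglongrightarrow> 0"
      using that by (auto intro!: tendsto_sandwich[OF _ _ tendsto_const hl])
    then have "(\<lambda>n. x + s n *\<^sub>R b + t n *\<^sub>R c) \<longlonglongrightarrow> x + 0 *\<^sub>R b + 0 *\<^sub>R c"
      by (intro tendsto_intros)
    then show ?thesis by simp
  qed
  define D where "D n = f (x + h n *\<^sub>R b + h n *\<^sub>R c) - f (x + h n *\<^sub>R b) - f (x + h n *\<^sub>R c) + f x" for n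
  have "\<forall>n. \<exists>s t. 0 \<le> s \<and> s \<le> h n \<and> 0 \<le> t \<and> t \<le> h n \<and>
      D n = h n * h n * fbc (x + s *\<^sub>R b + t *\<^sub>R c)"
    unfolding D_def using in_S h0 1 2
    by (intro allI second_difference_mvt[where S = S and fb = fb]) auto
  then obtain s t where st: "\<And>n. 0 \<le> s n \<and> s n \<le> h n" "\<And>n. 0 \<le> t n \<and> t n \<le> h n"
    "\<And>n. D n = h n * h n * fbc (x + s n *\<^sub>R b + t n *\<^sub>R c)" by metis
  have "\<exists>s t. 0 \<le> s \<and> s \<le> h n \<and> 0 \<le> t \<and> t \<le> h n \<and>
      D n = h n * h n * fcb (x + t *\<^sub>R b + s *\<^sub>R c)" for n
  proof -
    have "\<exists>s t. 0 \<le> s \<and> s \<le> h n \<and> 0 \<le> t \<and> t \<le> h n \<and>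
      f (x + h n *\<^sub>R c + h n *\<^sub>R b) - f (x + h n *\<^sub>R c) - f (x + h n *\<^sub>R b) + f x = h n * h n * fcb (x + s *\<^sub>R c + t *\<^sub>R b)"
      using in_S h0 1 2
      by (intro second_difference_mvt[where S = S and fb = fc]) (auto simp: add.assoc add.commute[of "_ *\<^sub>R c"])
    then show ?thesis unfolding D_def by (simp add: algebra_simps)
  qed
  then obtain s' t' where st': "\<And>n. 0 \<le> s' n \<and> s' n \<le> h n" "\<And>n. 0 \<le> t' n \<and> t' n \<le> h n"
    "\<And>n. D n = h n * h n * fcb (x + t' n *\<^sub>R b + s' n *\<^sub>R c)" by metis
  have "(\<lambda>n. fbc (x + s n *\<^sub>R b + t n *\<^sub>R c)) \<longlonglongrightarrow> fbc x"
    using st(1,2) \<open>x \<in> S\<close> by (intro continuous_on_tendsto_compose[OF 3(1) lim] always_eventually allI in_S) auto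
  moreover have "(\<lambda>n. fcb (x + t' n *\<^sub>R b + s' n *\<^sub>R c)) \<longlonglongrightarrow> fcb x"
    using st'(1,2) \<open>x \<in> S\<close> by (intro continuous_on_tendsto_compose[OF 3(2) lim] always_eventually allI in_S) auto
  moreover have "fcb (x + t' n *\<^sub>R b + s' n *\<^sub>R c) = fbc (x + s n *\<^sub>R b + t n *\<^sub>R c)" for n
    using st(3)[of n] st'(3)[of n] h0[of n] by simp
  ultimately show ?thesis using LIMSEQ_unique by auto
qed

lemma has_dd_inner_const: "has_dd f d b x \<Longrightarrow> has_dd (\<lambda>x. f x \<bullet> v) (d \<bullet> v) b x"
  by (rule has_dd_eq_rhs, rule has_dd_inner[OF _ has_dd_const], assumption) simp

text \<open>Needed to cancel the mixed second derivatives in the divergence of the stress-energy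
  tensor. The scalar statement is applied to each coordinate of \<open>u\<close>.\<close>

lemma pd_commute:
  fixes u :: "'a::euclidean_space \<Rightarrow> 'b::euclidean_space"
  assumes "Ck_on 2 u S" "open S" "x \<in> S" "b \<in> Basis" "c \<in> Basis"
  shows "pd c (pd b u) x = pd b (pd c u) x"
proof (rule euclidean_eqI)
  note C = Ck_on_2D[OF assms(1)]
  fix v :: 'b assume "v \<in> Basis"
  show "pd c (pd b u) x \<bullet> v = pd b (pd c u) x \<bullet> v"
    using assms(2-) C
    by (intro mixed_dd_commute[where f = "\<lambda>x. u x \<bullet> v" and fb = "\<lambda>x. pd b u x \<bullet> v"
          and fc = "\<lambda>x. pd c u x \<bullet> v" and S = S and b = b and c = c])
      (auto intro!: has_dd_inner_const has_dd_pd continuous_intros)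
qed

section \<open>Gluing with zero across the origin\<close>

text \<open>The quadratic bound makes the difference quotient at 0 of order t, so a function glued
  to zero stays differentiable there. This yields C^1 cutoffs from squared positive parts and the
  two derivatives of the truncation \<open>ramp\<close>.\<close>

lemma DERIV_extend_0:
  fixes F G :: "real \<Rightarrow> real"
  assumes D: "\<And>t. t > 0 \<Longrightarrow> (F has_real_derivative G t) (at t)"
    and 0: "\<And>t. t \<le> 0 \<Longrightarrow> F t = 0" "\<And>t. t \<le> 0 \<Longrightarrow> G t = 0"
    and bound: "\<And>t. t > 0 \<Longrightarrow> \<bar>F t\<bar> \<le> C * t\<^sup>2"
  shows "(F has_real_derivative G t) (at t)"
proof -
  consider "t > 0" | "t < 0" | "t = 0" by linarith
  then show ?thesis
  proof cases
    case 1 then show ?thesis by (rule D)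
  next
    case 2
    have "((\<lambda>t::real. 0) has_real_derivative 0) (at t)" by simp
    then have "(F has_real_derivative 0) (at t)"
      by (rule has_field_derivative_transform_within_open[where S = "{..<0}"]) (use 2 0 in auto)
    then show ?thesis using 2 0 by simp
  next
    case 3
    have "((\<lambda>h. F h / h) \<longlongrightarrow> 0) (at 0)"
    proof (rule Lim_null_comparison)
      show "\<forall>\<^sub>F h in at 0. norm (F h / h) \<le> \<bar>C\<bar> * \<bar>h\<bar>"
        unfolding eventually_at_filter
      proof (intro always_eventually allI impI)
        fix h :: real assume "h \<noteq> 0"
        show "norm (F h / h) \<le> \<bar>C\<bar> * \<bar>h\<bar>"
        proof (cases "h > 0")
          case True
          have "\<bar>F h\<bar> \<le> \<bar>C\<bar> * h\<^sup>2"
            using bound[OF True] by (rule order_trans) (simp add: mult_right_mono)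
          then show ?thesis using True by (simp add: divide_le_eq power2_eq_square mult.assoc)
        next
          case False
          then have "F h = 0" using 0 by simp
          moreover have "0 \<le> \<bar>C\<bar> * \<bar>h\<bar>" by (intro mult_nonneg_nonneg abs_ge_zero)
          ultimately show ?thesis by (simp only: div_0 norm_zero)
        qed
      qed
      show "((\<lambda>h::real. \<bar>C\<bar> * \<bar>h\<bar>) \<longlongrightarrow> 0) (at 0)"
        by (intro tendsto_mult_right_zero tendsto_rabs_zero tendsto_ident_at)
    qed
    then show ?thesis using 3 0 by (simp add: DERIV_def)
  qed
qed

lemma DERIV_max_0_square:
  "((\<lambda>t::real. (max 0 t)\<^sup>2) has_real_derivative 2 * max 0 t) (at t)"
proof (rule DERIV_extend_0[where C = 1])
  fix t :: real assume t: "t > 0"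
  have "((\<lambda>t::real. t\<^sup>2) has_real_derivative 2 * max 0 t) (at t)"
    using t by (auto intro!: derivative_eq_intros)
  then show "((\<lambda>t::real. (max 0 t)\<^sup>2) has_real_derivative 2 * max 0 t) (at t)"
    by (rule has_field_derivative_transform_within_open[where S = "{0<..}"]) (use t in auto)
qed auto

lemma has_dd_max_0_square:
  fixes f :: "'a::real_normed_vector \<Rightarrow> real"
  assumes "has_dd f d b x"
  shows "has_dd (\<lambda>x. (max 0 (f x))\<^sup>2) (2 * max 0 (f x) * d) b x"
  using has_dd_compose[OF assms, of "\<lambda>t. (max 0 t)\<^sup>2" "(*) (2 * max 0 (f x))"]
    DERIV_max_0_square[of "f x"] by (simp add: has_field_derivative_def)

lemma has_dd_affine:
  assumes "f differentiable (at (x + t *\<^sub>R z))"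
  shows "has_dd (\<lambda>z. f (x + t *\<^sub>R z)) (t *\<^sub>R pd b f (x + t *\<^sub>R z)) b z"
proof -
  have "((\<lambda>z. x + t *\<^sub>R z) has_derivative (\<lambda>z. t *\<^sub>R z)) (at z)"
    by (auto intro!: derivative_eq_intros)
  from has_dd_compose[OF has_dd_has_derivative[OF this, of b], of f]
  have "has_dd (\<lambda>z. f (x + t *\<^sub>R z)) (frechet_derivative f (at (x + t *\<^sub>R z)) (t *\<^sub>R b)) b z"
    using assms by (simp add: frechet_derivative_works)
  then show ?thesis
    using linear_cmul[OF linear_frechet_derivative[OF assms]] by simp
qed

section \<open>Mean value inequality\<close>

text \<open>The averages A(t) of w(x + t z) with weight \<open>\<psi>\<close> do not decrease in t.
  Indeed \<psi>(z) z is the gradient of \<open>\<Psi>\<close>, which is nonpositive and compactly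
  supported, so integration by parts gives A'(t) = - t times the integral of \<Psi> times the
  Laplacian of w. At t = 0 the average is w(x) times the integral of \<psi>; at t = r it is at most
  the rescaled integral over the cube, because \<psi> is at most 1 and w is nonnegative. No surface
  integrals occur.\<close>

lemma subharmonic_mean_value:
  fixes w :: "'a::euclidean_space \<Rightarrow> real"
  assumes C2: "Ck_on 2 w S" and "open S"
    and sub: "\<And>y. y \<in> S \<Longrightarrow> laplacian w y \<ge> 0" and pos: "\<And>y. y \<in> S \<Longrightarrow> w y \<ge> 0"
    and "r > 0" and box: "cbox (x - r *\<^sub>R One) (x + r *\<^sub>R One) \<subseteq> S"
  shows "w x * integral (cbox (- One) One) (\<lambda>z::'a. max 0 (1 - z \<bullet> z))
    \<le> integral (cbox (x - r *\<^sub>R One) (x + r *\<^sub>R One)) w / r ^ DIM('a)"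
proof -
  note C = Ck_on_2D[OF C2]
  define \<psi> where "\<psi> z = max 0 (1 - z \<bullet> z)" for z :: 'a
  define \<Psi> where "\<Psi> z = - (1/4) * (max 0 (1 - z \<bullet> z))\<^sup>2" for z :: 'a
  define B where "B = cbox (- One) (One :: 'a)"
  have in_S: "x + t *\<^sub>R z \<in> S" if "z \<in> B" "0 \<le> t" "t \<le> r" for t z
  proof -
    have "\<bar>t * (z \<bullet> i)\<bar> \<le> r * 1" if "i \<in> Basis" for i
      unfolding abs_mult using \<open>z \<in> B\<close> \<open>0 \<le> t\<close> \<open>t \<le> r\<close> that
      by (intro mult_mono) (auto simp: B_def mem_box abs_le_iff minus_le_iff)
    then have "x + t *\<^sub>R z \<in> cbox (x - r *\<^sub>R One) (x + r *\<^sub>R One)"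
      by (auto simp: mem_box inner_simps abs_le_iff minus_le_iff)
    then show ?thesis using box by blast
  qed
  have ball_B: "cball 0 1 \<subseteq> B"
  proof
    fix z :: 'a assume "z \<in> cball 0 1"
    then have "\<bar>z \<bullet> i\<bar> \<le> 1" if "i \<in> Basis" for i
      using Basis_le_norm[OF that, of z] by simp
    then show "z \<in> B" by (auto simp: B_def mem_box abs_le_iff minus_le_iff)
  qed
  have zero: "\<psi> z = 0" "\<Psi> z = 0" if "z \<notin> cball 0 1" for z
  proof -
    have "z \<bullet> z > 1" using that by (simp add: dot_square_norm)
    then show "\<psi> z = 0" "\<Psi> z = 0" by (auto simp: \<psi>_def \<Psi>_def max_def)
  qed
  have d\<Psi>: "has_dd \<Psi> (\<psi> z * (z \<bullet> b)) b z" for z b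
    unfolding \<Psi>_def \<psi>_def
    apply (rule has_dd_eq_rhs)
     apply (rule dd_intros has_dd_max_0_square has_dd_has_derivative[where f = "\<lambda>x. x" and f' = "\<lambda>x. x"] has_derivative_ident)+
    apply (simp add: inner_commute)
    done
  have cont: "continuous_on A \<psi>" "continuous_on A \<Psi>" for A
    unfolding \<psi>_def \<Psi>_def by (intro continuous_intros)+
  define f1 where "f1 t z = (\<Sum>b\<in>Basis. \<psi> z * (z \<bullet> b) * pd b w (x + t *\<^sub>R z))" for t z
  define A where "A t = integral B (\<lambda>z. \<psi> z * w (x + t *\<^sub>R z))" for t
  have cf1: "continuous_on ({0..r} \<times> B) (\<lambda>(t, z). f1 t z)"
    unfolding f1_def split_beta using in_S cont
    by (intro continuous_intros continuous_on_compose2[OF C(4)] continuous_on_compose2[OF cont(1)[of UNIV]]) auto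
  have cw: "continuous_on B (\<lambda>z. w (x + t *\<^sub>R z))" if "0 \<le> t" "t \<le> r" for t
    using that in_S by (intro continuous_on_compose2[OF C(5)] continuous_intros) auto
  have dA: "(A has_vector_derivative integral B (f1 t)) (at t within {0..r})" if "t \<in> {0..r}" for t
    unfolding A_def[abs_def] B_def
  proof (rule leibniz_rule_vector_derivative)
    fix t z assume tz: "t \<in> {0..r}" "z \<in> cbox (- One) (One::'a)"
    then have D: "w differentiable (at (x + t *\<^sub>R z))" using C(1) in_S by (auto simp: B_def)
    have lin: "linear (frechet_derivative w (at (x + t *\<^sub>R z)))"
      using D by (rule linear_frechet_derivative)
    have "((\<lambda>t. w (x + t *\<^sub>R z)) has_real_derivative frechet_derivative w (at (x + t *\<^sub>R z)) z) (at t)"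
      by (rule has_dd_DERIV) (rule has_dd_pd[OF D])
    also have "frechet_derivative w (at (x + t *\<^sub>R z)) z
        = frechet_derivative w (at (x + t *\<^sub>R z)) (\<Sum>b\<in>Basis. (z \<bullet> b) *\<^sub>R b)"
      by (simp add: euclidean_representation)
    also have "\<dots> = (\<Sum>b\<in>Basis. (z \<bullet> b) * pd b w (x + t *\<^sub>R z))"
      by (simp add: linear_sum[OF lin] linear_cmul[OF lin])
    finally have "((\<lambda>t. \<psi> z * w (x + t *\<^sub>R z)) has_real_derivative \<psi> z * (\<Sum>b\<in>Basis. (z \<bullet> b) * pd b w (x + t *\<^sub>R z))) (at t)"
      by (rule DERIV_cmult)
    then show "((\<lambda>t. \<psi> z * w (x + t *\<^sub>R z)) has_vector_derivative f1 t z) (at t within {0..r})"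
      by (auto simp: f1_def sum_distrib_left mult.assoc has_real_derivative_iff_has_vector_derivative
          intro: has_vector_derivative_at_within)
  next
    show "(\<lambda>z. \<psi> z * w (x + t *\<^sub>R z)) integrable_on cbox (- One) One" if "t \<in> {0..r}" for t
      using that cw cont unfolding B_def by (intro integrable_continuous continuous_intros) auto
  qed (use that cf1 in \<open>auto simp: B_def\<close>)
  have A'_nonneg: "integral B (f1 t) \<ge> 0" if t: "t \<in> {0..r}" for t
  proof -
    define St where "St = {z. x + t *\<^sub>R z \<in> S}"
    have St: "open St" unfolding St_def
      using open_vimage[OF \<open>open S\<close>, of "\<lambda>z. x + t *\<^sub>R z"]
      by (simp add: vimage_def continuous_intros)
    have KSt: "cball 0 1 \<subseteq> St" using ball_B in_S t by (auto simp: St_def)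
    \<comment> \<open>The derivative along b of \<Psi>(z) times the partial derivative of w at x + t
      z. Summed over b it equals \<open>f1 t z\<close> plus t \<Psi> times the Laplacian of w, a
      nonpositive term, while its integral is zero.\<close>
    define g where "g b z = \<psi> z * (z \<bullet> b) * pd b w (x + t *\<^sub>R z)
        + \<Psi> z * (t *\<^sub>R pd b (pd b w) (x + t *\<^sub>R z))" for b z
    have g: "integrable lborel (g b)" "integral\<^sup>L lborel (g b) = 0" if b: "b \<in> Basis" for b
    proof -
      have dd: "has_dd (\<lambda>z. \<Psi> z * pd b w (x + t *\<^sub>R z)) (g b z) b z" if "z \<in> St" for z
        unfolding g_def using that b C(2)
        by (intro has_dd_mult d\<Psi> has_dd_affine) (auto simp: St_def)
      have c1: "continuous_on St (\<lambda>z. \<Psi> z * pd b w (x + t *\<^sub>R z))"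
        using b by (intro continuous_intros cont continuous_on_compose2[OF C(4)]) (auto simp: St_def)
      have c2: "continuous_on St (g b)"
        unfolding g_def using b
        by (intro continuous_intros cont continuous_on_compose2[OF C(4)] continuous_on_compose2[OF C(3)])
          (auto simp: St_def)
      have z1: "\<Psi> z * pd b w (x + t *\<^sub>R z) = 0" "g b z = 0" if "z \<notin> cball 0 1" for z
        unfolding g_def using zero[OF that] by simp_all
      show "integrable lborel (g b)" "integral\<^sup>L lborel (g b) = 0"
        using integral_dd_zero[OF St compact_cball KSt dd c1 c2 z1] by blast+
    qed
    have "(g b has_integral 0) UNIV" if "b \<in> Basis" for b
      using has_integral_integral_lborel[OF g(1)[OF that]] g(2)[OF that] by simp
    then have "((\<lambda>z. \<Sum>b\<in>Basis. g b z) has_integral (\<Sum>b\<in>(Basis::'a set). 0)) UNIV"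
      by (intro has_integral_sum finite_Basis)
    moreover have "(if z \<in> B then \<Sum>b\<in>Basis. g b z else 0) = (\<Sum>b\<in>Basis. g b z)" for z
    proof (cases "z \<in> B")
      case False
      then have "z \<notin> cball 0 1" using ball_B by blast
      from zero[OF this] False show ?thesis by (simp add: g_def)
    qed simp
    ultimately have G: "((\<lambda>z. \<Sum>b\<in>Basis. g b z) has_integral 0) B"
      using has_integral_restrict_UNIV[of B "\<lambda>z. \<Sum>b\<in>Basis. g b z" 0] by (simp only: sum.neutral_const)
    have "continuous_on B (f1 t)"
    proof -
      have "continuous_on B (\<lambda>z. (t, z))"
        by (intro continuous_on_Pair continuous_on_const continuous_on_id)
      from continuous_on_compose2[OF cf1 this] t show ?thesis by (auto simp: image_subset_iff)
    qed
    then have F: "(f1 t has_integral integral B (f1 t)) B"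
      unfolding B_def by (rule integrable_integral[OF integrable_continuous])
    show ?thesis
    proof (rule has_integral_le[OF G F])
      fix z assume "z \<in> B"
      then have "x + t *\<^sub>R z \<in> S" using in_S t by auto
      then have "0 \<le> t * laplacian w (x + t *\<^sub>R z)" using sub t by auto
      moreover have "\<Psi> z \<le> 0" by (simp add: \<Psi>_def)
      ultimately have "\<Psi> z * (t * laplacian w (x + t *\<^sub>R z)) \<le> 0" by (rule mult_nonpos_nonneg[rotated])
      then show "(\<Sum>b\<in>Basis. g b z) \<le> f1 t z"
        by (simp add: g_def f1_def sum.distrib laplacian_def sum_distrib_left)
    qed
  qed
  have "\<exists>t\<in>{0<..<r}. A r - A 0 = (\<lambda>h. h *\<^sub>R integral B (f1 t)) (r - 0)"
    using \<open>r > 0\<close> dA unfolding has_vector_derivative_def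
    by (intro mvt_simple) auto
  then obtain t where "t \<in> {0<..<r}" "A r - A 0 = r * integral B (f1 t)" by auto
  then have "A 0 \<le> A r" using A'_nonneg[of t] \<open>r > 0\<close> by (smt (verit) atLeastAtMost_iff greaterThanLessThan_iff mult_nonneg_nonneg)
  moreover have "A 0 = w x * integral B \<psi>"
  proof -
    have "A 0 = integral B (\<lambda>z. \<psi> z * w x)" by (simp add: A_def)
    also have "\<dots> = integral B \<psi> * w x" by (rule integral_mult_left)
    finally show ?thesis by simp
  qed
  moreover have "A r \<le> integral B (\<lambda>z. w (r *\<^sub>R z + x))"
    unfolding A_def
  proof (rule integral_le)
    show "(\<lambda>z. \<psi> z * w (x + r *\<^sub>R z)) integrable_on B" "(\<lambda>z. w (r *\<^sub>R z + x)) integrable_on B"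
      using \<open>r > 0\<close> cw[of r] cont unfolding B_def
      by (intro integrable_continuous continuous_intros; simp add: add.commute)+
    fix z assume "z \<in> B"
    then have "w (x + r *\<^sub>R z) \<ge> 0" using pos in_S \<open>r > 0\<close> by simp
    moreover have "0 \<le> \<psi> z" "\<psi> z \<le> 1" by (auto simp: \<psi>_def)
    ultimately show "\<psi> z * w (x + r *\<^sub>R z) \<le> w (r *\<^sub>R z + x)"
      by (simp add: mult_left_le_one_le add.commute)
  qed
  moreover have "((\<lambda>z. w (r *\<^sub>R z + x)) has_integral
      (integral (cbox (x - r *\<^sub>R One) (x + r *\<^sub>R One)) w /\<^sub>R r ^ DIM('a))) B"
  proof -
    have "w integrable_on cbox (x - r *\<^sub>R One) (x + r *\<^sub>R One)"
      using C(5) box by (intro integrable_continuous) (rule continuous_on_subset)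
    from has_integral_affinity'[OF integrable_integral[OF this] \<open>r > 0\<close>, of x]
    show ?thesis using \<open>r > 0\<close> by (simp add: B_def)
  qed
  then have "integral B (\<lambda>z. w (r *\<^sub>R z + x))
      = integral (cbox (x - r *\<^sub>R One) (x + r *\<^sub>R One)) w /\<^sub>R r ^ DIM('a)"
    by (rule integral_unique)
  ultimately have "w x * integral B \<psi> \<le> integral (cbox (x - r *\<^sub>R One) (x + r *\<^sub>R One)) w /\<^sub>R r ^ DIM('a)"
    by linarith
  then show ?thesis
    by (simp only: \<psi>_def[abs_def] B_def real_scaleR_def divide_inverse mult.commute[of "inverse _"])
qed

section \<open>Interior gradient bound\<close>

text \<open>At the maximum k1 vanishes; were k2 positive, k1 would be positive just to the right of
  0 and k would exceed its value at 0.\<close>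

lemma second_DERIV_local_max:
  fixes k :: "real \<Rightarrow> real"
  assumes "e > 0"
    and 1: "\<And>t. \<bar>t\<bar> < e \<Longrightarrow> (k has_real_derivative k1 t) (at t)"
    and 2: "(k1 has_real_derivative k2) (at 0)"
    and max: "\<And>t. \<bar>t\<bar> < e \<Longrightarrow> k t \<le> k 0"
  shows "k2 \<le> 0"
proof (rule ccontr)
  assume "\<not> k2 \<le> 0"
  then obtain d where d: "d > 0" "\<And>h. h > 0 \<Longrightarrow> h < d \<Longrightarrow> k1 0 < k1 (0 + h)"
    using DERIV_pos_inc_right[OF 2] by auto
  have "k1 0 = 0" using 1[of 0] \<open>e > 0\<close> max by (intro DERIV_local_max[of k _ 0 e]) auto
  define h where "h = min d e / 2"
  have h: "0 < h" "h < d" "h < e" using d \<open>e > 0\<close> by (auto simp: h_def min_def)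
  have "\<exists>z. z > 0 \<and> z < h \<and> k h - k 0 = (h - 0) * k1 z"
    using h 1 by (intro MVT2) auto
  then obtain z where "0 < z" "z < h" "k h - k 0 = h * k1 z" by auto
  moreover have "k1 z > 0" using d(2)[of z] calculation h \<open>k1 0 = 0\<close> by simp
  ultimately have "k h > k 0" using h by (smt (verit) mult_pos_pos)
  then show False using max[of h] h by simp
qed

text \<open>
  Brandt's comparison argument: the odd part of \<open>f\<close> in the direction \<open>b\<close>, minus a quadratic
  barrier, has no interior maximum on the half ball. Only second derivatives of \<open>f\<close> occur.
\<close>

lemma partial_derivative_bound:
  fixes f :: "'a::euclidean_space \<Rightarrow> real" and d M N :: real
  assumes C2: "Ck_on 2 f S" and "open S" and "d > 0" and ball: "cball x d \<subseteq> S"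
    and M: "\<And>y. y \<in> cball x d \<Longrightarrow> \<bar>f y\<bar> \<le> M"
    and N: "\<And>y. y \<in> cball x d \<Longrightarrow> \<bar>laplacian f y\<bar> \<le> N"
    and b: "b \<in> Basis"
  shows "pd b f x \<le> DIM('a) * M / d + N * d / 2"
proof -
  note C = Ck_on_2D[OF C2]
  \<comment> \<open>Reflection in the hyperplane orthogonal to b; \<open>s c\<close> is its
    eigenvalue on the basis vector c.\<close>
  define R where "R z = z - (2 * (z \<bullet> b)) *\<^sub>R b" for z :: 'a
  define s where "s c = (if c = b then -1 else 1 :: real)" for c
  have R_basis: "R c = s c *\<^sub>R c" if "c \<in> Basis" for c
    using that b by (simp add: R_def s_def inner_Basis scaleR_2)
  have R_lin: "R (z + y) = R z + R y" "R (t *\<^sub>R y) = t *\<^sub>R R y" for z y t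
    by (simp_all add: R_def inner_simps algebra_simps)
  have normR: "norm (R z) = norm z" for z
  proof -
    have "R z \<bullet> R z = z \<bullet> z"
      using b by (simp add: R_def inner_simps inner_commute algebra_simps)
    then show ?thesis by (simp add: norm_eq_sqrt_inner)
  qed
  have M0: "M \<ge> 0" using M[of x] \<open>d > 0\<close> by fastforce
  \<comment> \<open>The Laplacian of \<open>F\<close> below is at least - 2 N - 2 A DIM('a) + 2 K
    with A = 2 M / d^2; the condition on K says exactly that this is positive.\<close>
  have key: "pd b f x \<le> K * d / 2" if K: "K > N + 2 * M * DIM('a) / d\<^sup>2" for K
  proof -
    define A where "A = 2 * M / d\<^sup>2"
    have "A \<ge> 0" using M0 by (simp add: A_def)
    have "N \<ge> 0" using N[of x] \<open>d > 0\<close> by fastforce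
    moreover have "2 * M * DIM('a) / d\<^sup>2 \<ge> 0" using M0 by simp
    ultimately have "K > 0" using K by linarith
    \<comment> \<open>Both barrier terms are nonnegative on the half ball. With A = 2 M / d^2 the
      first equals 2 M on the sphere of radius d and so dominates the odd part there; the second has
      the Laplacian - 2 K and vanishes on the flat face.\<close>
    define F where "F z = f (x + z) - f (x + R z) - (A * (z \<bullet> z) + K * ((z \<bullet> b) * d - (z \<bullet> b) * (z \<bullet> b)))" for z
    define F1 where "F1 c z = pd c f (x + z) - s c * pd c f (x + R z)
        - (A * (2 * (z \<bullet> c)) + K * ((c \<bullet> b) * d - 2 * ((z \<bullet> b) * (c \<bullet> b))))" for c z
    define F2 where "F2 c z = pd c (pd c f) (x + z) - pd c (pd c f) (x + R z)
        - (2 * A - 2 * K * (c \<bullet> b)\<^sup>2)" for c z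
    define H where "H = cball 0 d \<inter> {z. z \<bullet> b \<ge> 0}"
    have dR: "has_dd (\<lambda>z. g (x + R z)) (s c *\<^sub>R pd c g (x + R z)) c z"
      if "g differentiable (at (x + R z))" "c \<in> Basis" for g :: "'a \<Rightarrow> real" and c z
    proof -
      have "has_dd (\<lambda>z. x + R z) (R c) c z"
        unfolding has_dd_def R_lin by (auto intro!: derivative_eq_intros)
      from has_dd_compose[OF this, of g "frechet_derivative g (at (x + R z))"] that
      show ?thesis
        using linear_cmul[OF linear_frechet_derivative[OF that(1)]]
        by (simp add: frechet_derivative_works R_basis)
    qed
    have dI: "has_dd (\<lambda>z. g (x + z)) (pd c g (x + z)) c z"
      if "g differentiable (at (x + z))" for g :: "'a \<Rightarrow> real" and c z
      using has_dd_affine[of g x 1 z c] that by simp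
    have dd1: "has_dd F (F1 c z) c z" if z: "norm z < d" and c: "c \<in> Basis" for z c
    proof -
      have "x + z \<in> S" "x + R z \<in> S" using z normR ball by (auto simp: subset_iff dist_norm)
      then show ?thesis
        unfolding F_def
        apply (intro has_dd_eq_rhs[OF has_dd_diff[OF has_dd_diff[OF dI dR]
              has_dd_add[OF has_dd_mult[OF has_dd_const has_dd_inner] has_dd_mult[OF has_dd_const has_dd_diff[OF has_dd_mult has_dd_mult]]]]] C(1) c)
        apply (assumption | rule c has_dd_coord has_dd_const has_dd_has_derivative[where f = "\<lambda>x. x" and f' = "\<lambda>x. x"] has_derivative_ident)+
        apply (simp add: F1_def inner_commute algebra_simps)
        done
    qed
    have dd2: "has_dd (F1 c) (F2 c z) c z" if z: "norm z < d" and c: "c \<in> Basis" for z c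
    proof -
      have "x + z \<in> S" "x + R z \<in> S" using z normR ball by (auto simp: subset_iff dist_norm)
      then show ?thesis
        unfolding F1_def
        apply (intro has_dd_eq_rhs[OF has_dd_diff[OF has_dd_diff[OF dI has_dd_mult[OF has_dd_const dR]]
              has_dd_add[OF has_dd_mult[OF has_dd_const has_dd_mult[OF has_dd_const has_dd_coord]] has_dd_mult[OF has_dd_const has_dd_diff[OF has_dd_const has_dd_mult[OF has_dd_const has_dd_mult]]]]]] C(2) c)
        apply (assumption | rule c has_dd_coord has_dd_const)+
        using c apply (simp add: F2_def s_def inner_Basis b power2_eq_square algebra_simps)
        done
    qed
    have sumF2: "(\<Sum>c\<in>Basis. F2 c z) > 0" if "norm z < d" for z
    proof -
      have "x + z \<in> cball x d" "x + R z \<in> cball x d" using that normR by (auto simp: dist_norm)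
      then have "laplacian f (x + z) \<ge> - N" "laplacian f (x + R z) \<le> N" using N by (auto simp: abs_le_iff minus_le_iff)
      moreover have "(\<Sum>c\<in>Basis. (c \<bullet> b)\<^sup>2) = 1"
        using b euclidean_inner[of b b] by (simp add: power2_eq_square inner_commute)
      then have "(\<Sum>c\<in>Basis. F2 c z) = laplacian f (x + z) - laplacian f (x + R z) - 2 * A * DIM('a) + 2 * K"
        by (simp add: F2_def laplacian_def sum_subtractf sum_distrib_left[symmetric])
      moreover have "2 * A * DIM('a) = 2 * (2 * M * DIM('a) / d\<^sup>2)" by (simp add: A_def)
      ultimately show ?thesis using K by linarith
    qed
    have "compact H" unfolding H_def
      by (intro compact_Int_closed closed_Collect_le continuous_intros) auto
    moreover have "0 \<in> H" using \<open>d > 0\<close> by (simp add: H_def)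
    moreover have "continuous_on H F"
    proof -
      have "continuous_on (cball 0 d) (\<lambda>z. f (x + z))" "continuous_on (cball 0 d) (\<lambda>z. f (x + R z))"
      proof -
        have "x + z \<in> S" "x + R z \<in> S" if "z \<in> cball 0 d" for z
          using that ball normR by (auto simp: subset_iff dist_norm)
        moreover have "continuous_on (cball 0 d) R" unfolding R_def by (intro continuous_intros)
        ultimately show "continuous_on (cball 0 d) (\<lambda>z. f (x + z))"
            "continuous_on (cball 0 d) (\<lambda>z. f (x + R z))"
          by (auto intro!: continuous_on_compose2[OF C(5), where f = "\<lambda>z. x + z"]
              continuous_on_compose2[OF C(5), where f = "\<lambda>z. x + R z"] continuous_intros simp del: mem_cball mem_cball_0)
      qed
      then have "continuous_on H (\<lambda>z. f (x + z))" "continuous_on H (\<lambda>z. f (x + R z))"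
        by (auto simp: H_def elim: continuous_on_subset)
      then show ?thesis unfolding F_def by (intro continuous_intros)
    qed
    ultimately obtain z where z: "z \<in> H" and zmax: "\<And>y. y \<in> H \<Longrightarrow> F y \<le> F z"
      using continuous_attains_sup[of H F] by blast
    have zb: "0 \<le> z \<bullet> b" "z \<bullet> b \<le> d"
      using z Basis_le_norm[OF b, of z] by (auto simp: H_def)
    have pos: "A * (z \<bullet> z) \<ge> 0" "K * ((z \<bullet> b) * d - (z \<bullet> b) * (z \<bullet> b)) \<ge> 0"
      using \<open>A \<ge> 0\<close> \<open>K > 0\<close> zb by (auto intro!: mult_nonneg_nonneg mult_left_mono)
    \<comment> \<open>The maximum lies on the flat face, where z is its own reflection, or on the
      sphere, where the barrier dominates, or inside, where the positive Laplacian of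
      \<open>F\<close> contradicts the second derivative test in each coordinate direction.\<close>
    have "F z \<le> 0"
    proof -
      consider "z \<bullet> b = 0" | "norm z = d" | "z \<bullet> b > 0" "norm z < d"
        using z by (fastforce simp: H_def)
      then show ?thesis
      proof cases
        case 1
        then have "R z = z" by (simp add: R_def)
        then show ?thesis using pos by (simp add: F_def)
      next
        case 2
        have "x + z \<in> cball x d" "x + R z \<in> cball x d" using 2 normR by (auto simp: dist_norm)
        then have "f (x + z) - f (x + R z) \<le> 2 * M" using M by (smt (verit))
        moreover have "A * (z \<bullet> z) = 2 * M"
          using 2 \<open>d > 0\<close> by (simp add: A_def dot_square_norm)
        ultimately show ?thesis using pos by (simp add: F_def)
      next
        case 3
        have "open (ball 0 d \<inter> {z. z \<bullet> b > 0})"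
          by (intro open_Int open_Collect_less continuous_intros) auto
        moreover have "z \<in> ball 0 d \<inter> {z. z \<bullet> b > 0}" using 3 by simp
        ultimately obtain e where e: "e > 0" "ball z e \<subseteq> ball 0 d \<inter> {z. z \<bullet> b > 0}"
          by (rule openE)
        have ineq: "F2 c z \<le> 0" if c: "c \<in> Basis" for c
        proof (rule second_DERIV_local_max[OF e(1)])
          have ball: "z + t *\<^sub>R c \<in> ball 0 d \<inter> {z. z \<bullet> b > 0}" if "\<bar>t\<bar> < e" for t
            using that c by (intro subsetD[OF e(2)]) (simp add: dist_norm)
          show "((\<lambda>t. F (z + t *\<^sub>R c)) has_real_derivative F1 c (z + t *\<^sub>R c)) (at t)" if "\<bar>t\<bar> < e" for t
            using ball[OF that] c by (intro has_dd_DERIV dd1) auto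
          show "((\<lambda>t. F1 c (z + t *\<^sub>R c)) has_real_derivative F2 c z) (at 0)"
            using 3 c dd2[of z c] by (intro has_dd_DERIV) auto
          show "F (z + t *\<^sub>R c) \<le> F (z + 0 *\<^sub>R c)" if "\<bar>t\<bar> < e" for t
            using ball[OF that] zmax[of "z + t *\<^sub>R c"] by (auto simp: H_def)
        qed
        then have "(\<Sum>c\<in>Basis. F2 c z) \<le> 0" by (intro sum_nonpos)
        then show ?thesis using sumF2[OF 3(2)] by simp
      qed
    qed
    \<comment> \<open>Along b the function starts at F(0) = 0 and never becomes positive, so its
      slope at 0, twice the partial derivative minus K d, cannot be positive.\<close>
    have F_le: "F (t *\<^sub>R b) \<le> 0" if "0 \<le> t" "t < d" for t
      using zmax[of "t *\<^sub>R b"] \<open>F z \<le> 0\<close> that b by (auto simp: H_def)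
    have "((\<lambda>t. F (0 + t *\<^sub>R b)) has_real_derivative F1 b 0) (at 0)"
      using dd1[of 0 b] b \<open>d > 0\<close> by (intro has_dd_DERIV) auto
    moreover have "F1 b 0 = 2 * pd b f x - K * d"
      using b by (simp add: F1_def s_def R_def)
    moreover have "F 0 = 0" by (simp add: F_def R_def)
    ultimately have "\<not> 2 * pd b f x - K * d > 0"
    proof -
      assume D: "((\<lambda>t. F (0 + t *\<^sub>R b)) has_real_derivative F1 b 0) (at 0)" "F1 b 0 = 2 * pd b f x - K * d" "F 0 = 0"
      show ?thesis
      proof
        assume "2 * pd b f x - K * d > 0"
        then obtain e where e: "e > 0" "\<And>h. h > 0 \<Longrightarrow> h < e \<Longrightarrow> F (0 + 0 *\<^sub>R b) < F (0 + (0 + h) *\<^sub>R b)"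
          using DERIV_pos_inc_right[OF D(1)] D(2) by auto
        have "min e d / 2 > 0" "min e d / 2 < e" "min e d / 2 < d"
          using e(1) \<open>d > 0\<close> by (auto simp: min_def)
        then show False using e(2)[of "min e d / 2"] F_le[of "min e d / 2"] D(3) by simp
      qed
    qed
    then show ?thesis by simp
  qed
  \<comment> \<open>\<open>key\<close> needs a strict inequality for K, so K exceeds the threshold
    by 2 e / d, which costs e.\<close>
  have "pd b f x \<le> (N + 2 * M * DIM('a) / d\<^sup>2) * d / 2"
  proof (rule field_le_epsilon)
    fix e :: real assume "e > 0"
    have "pd b f x \<le> (N + 2 * M * DIM('a) / d\<^sup>2 + 2 * e / d) * d / 2"
      using \<open>e > 0\<close> \<open>d > 0\<close> by (intro key) auto
    also have "\<dots> = (N + 2 * M * DIM('a) / d\<^sup>2) * d / 2 + e"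
      using \<open>d > 0\<close> by (simp add: field_simps)
    finally show "pd b f x \<le> (N + 2 * M * DIM('a) / d\<^sup>2) * d / 2 + e" .
  qed
  also have "\<dots> = DIM('a) * M / d + N * d / 2"
    using \<open>d > 0\<close> by (simp add: field_simps power2_eq_square)
  finally show ?thesis .
qed

section \<open>A convex truncation\<close>

text \<open>
  The composition of \<open>ramp\<close> with \<open>|u|\<^sup>2 - R\<^sup>2\<close> has to be of class \<open>C\<^sup>2\<close> and subharmonic, hence
  convexity; it has to be integrable with a bound given by the potential energy, hence linear growth.
\<close>

definition ramp :: "real \<Rightarrow> real" where
  "ramp t = (if t \<le> 0 then 0 else t ^ 3 / (1 + t)\<^sup>2)"

definition ramp' :: "real \<Rightarrow> real" where
  "ramp' t = (if t \<le> 0 then 0 else t\<^sup>2 * (3 + t) / (1 + t) ^ 3)"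

text \<open>Written with \<open>max 0 t\<close> rather than by cases, so that continuity across 0
  can be read off.\<close>

definition ramp'' :: "real \<Rightarrow> real" where
  "ramp'' t = 6 * max 0 t / (1 + max 0 t) ^ 4"

lemma DERIV_ramp: "(ramp has_real_derivative ramp' t) (at t)"
proof (rule DERIV_extend_0[where C = 1])
  fix t :: real assume t: "t > 0"
  have "((\<lambda>t. t ^ 3 / (1 + t)\<^sup>2) has_real_derivative ramp' t) (at t)"
    using t apply (auto simp: ramp'_def intro!: derivative_eq_intros)
    apply (simp add: divide_simps power2_eq_square power3_eq_cube)
    apply algebra
    done
  then show "(ramp has_real_derivative ramp' t) (at t)"
    by (rule has_field_derivative_transform_within_open[where S = "{0<..}"]) (use t in \<open>auto simp: ramp_def\<close>)
  have "t ^ 3 \<le> t\<^sup>2 * (1 + t)\<^sup>2"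
    using t by (simp add: power2_eq_square power3_eq_cube algebra_simps)
  then show "\<bar>ramp t\<bar> \<le> 1 * t\<^sup>2" using t by (simp add: ramp_def divide_le_eq)
qed (auto simp: ramp_def ramp'_def)

lemma DERIV_ramp': "(ramp' has_real_derivative ramp'' t) (at t)"
proof (rule DERIV_extend_0[where C = 3])
  fix t :: real assume t: "t > 0"
  have "((\<lambda>t. t\<^sup>2 * (3 + t) / (1 + t) ^ 3) has_real_derivative ramp'' t) (at t)"
    using t apply (auto simp: ramp''_def intro!: derivative_eq_intros)
    apply (simp add: divide_simps power2_eq_square power3_eq_cube power4_eq_xxxx)
    apply algebra
    done
  then show "(ramp' has_real_derivative ramp'' t) (at t)"
    by (rule has_field_derivative_transform_within_open[where S = "{0<..}"]) (use t in \<open>auto simp: ramp'_def\<close>)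
  have "3 + t \<le> 3 * (1 + t) ^ 3"
    using t by (simp add: power3_eq_cube algebra_simps)
  then have "t\<^sup>2 * (3 + t) \<le> t\<^sup>2 * (3 * (1 + t) ^ 3)" by (intro mult_left_mono) auto
  then show "\<bar>ramp' t\<bar> \<le> 3 * t\<^sup>2" using t by (simp add: ramp'_def divide_le_eq algebra_simps)
qed (auto simp: ramp'_def ramp''_def)

lemma ramp_nonneg: "0 \<le> ramp t" and ramp'_nonneg: "0 \<le> ramp' t" and ramp''_nonneg: "0 \<le> ramp'' t"
  by (auto simp: ramp_def ramp'_def ramp''_def)

lemma ramp_le: "ramp t \<le> max 0 t"
proof -
  have "t ^ 3 \<le> t * (1 + t)\<^sup>2" if "t > 0"
    using that by (simp add: power2_eq_square power3_eq_cube algebra_simps)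
  then show ?thesis by (simp add: ramp_def divide_le_eq)
qed

text \<open>The line t - 2 is the asymptote at infinity: for t > 0 the difference is (3 t + 2) / (1
  + t)^2. It turns a bound on the truncation back into one on its argument.\<close>

lemma le_ramp: "t - 2 \<le> ramp t"
proof -
  have "(t - 2) * (1 + t)\<^sup>2 \<le> t ^ 3" if "t > 0"
    using that by (simp add: power2_eq_square power3_eq_cube algebra_simps)
  then show ?thesis by (simp add: ramp_def le_divide_eq)
qed

text \<open>With q = |u|^2 - R^2 the Laplacian is \<open>ramp''\<close> times |grad q|^2 plus 2
  \<open>ramp'\<close> times the sum of |grad u|^2 and the inner product of u with its Laplacian.
  That inner product has no known sign only where |u| is at most R, and there \<open>ramp'\<close>
  vanishes.\<close>

lemma subharmonic_ramp_norm:
  fixes u :: "'a::euclidean_space \<Rightarrow> 'b::euclidean_space"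
  assumes C2: "Ck_on 2 u S" and "open S" and "R \<ge> 0"
    and out: "\<And>x. x \<in> S \<Longrightarrow> norm (u x) > R \<Longrightarrow> u x \<bullet> laplacian u x \<ge> 0"
  shows "Ck_on 2 (\<lambda>x. ramp (u x \<bullet> u x - R\<^sup>2)) S"
    and "x \<in> S \<Longrightarrow> laplacian (\<lambda>x. ramp (u x \<bullet> u x - R\<^sup>2)) x \<ge> 0"
proof -
  note C = Ck_on_2D[OF C2]
  define q where "q x = u x \<bullet> u x - R\<^sup>2" for x
  define Du where "Du x = frechet_derivative u (at x)" for x
  define DDu where "DDu b x = frechet_derivative (pd b u) (at x)" for b x
  define w' where "w' x v = ramp' (q x) * (2 * (u x \<bullet> Du x v))" for x v
  define w'' where "w'' b x v = ramp'' (q x) * (2 * (u x \<bullet> Du x v)) * (2 * (u x \<bullet> pd b u x))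
      + ramp' (q x) * (2 * (u x \<bullet> DDu b x v + Du x v \<bullet> pd b u x))" for b x v
  have Du: "(u has_derivative Du x) (at x)" if "x \<in> S" for x
    using C(1)[OF that] by (simp add: Du_def frechet_derivative_works)
  have DDu: "(pd b u has_derivative DDu b x) (at x)" if "x \<in> S" "b \<in> Basis" for x b
    using C(2)[OF that] by (simp add: DDu_def frechet_derivative_works)
  have q: "(q has_derivative (\<lambda>v. 2 * (u x \<bullet> Du x v))) (at x)" if "x \<in> S" for x
    unfolding q_def[abs_def] using Du[OF that]
    by (auto intro!: derivative_eq_intros simp: inner_commute)
  have d1: "((\<lambda>x. ramp (q x)) has_derivative w' x) (at x)" if "x \<in> S" for x
    unfolding w'_def
    using has_derivative_compose[OF q[OF that] DERIV_ramp[unfolded has_field_derivative_def]] .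
  have dr: "((\<lambda>x. ramp' (q x)) has_derivative (\<lambda>v. ramp'' (q x) * (2 * (u x \<bullet> Du x v)))) (at x)" if "x \<in> S" for x
    using has_derivative_compose[OF q[OF that] DERIV_ramp'[unfolded has_field_derivative_def]] .
  have d2: "((\<lambda>x. w' x b) has_derivative w'' b x) (at x)" if "x \<in> S" "b \<in> Basis" for x b
  proof -
    have "((\<lambda>x. ramp' (q x) * (2 * (u x \<bullet> pd b u x))) has_derivative w'' b x) (at x)"
      by (rule has_derivative_eq_rhs)
        (rule has_derivative_mult[OF dr[OF \<open>x \<in> S\<close>] has_derivative_mult_right[OF has_derivative_inner[OF Du[OF that(1)] DDu[OF that]]]],
          auto simp: w''_def algebra_simps)
    then show ?thesis by (simp add: w'_def Du_def)
  qed
  have cq: "continuous_on S q" unfolding q_def[abs_def] by (intro continuous_intros C(5))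
  have cr': "continuous_on UNIV ramp'"
    using DERIV_ramp' by (meson DERIV_continuous continuous_at_imp_continuous_on)
  have cr'': "continuous_on UNIV ramp''"
    unfolding ramp''_def[abs_def] by (intro continuous_intros) (auto simp: add_pos_nonneg less_imp_neq[symmetric] max_def)
  have c2: "continuous_on S (\<lambda>x. w'' b x c)" if "b \<in> Basis" "c \<in> Basis" for b c
    unfolding w''_def Du_def DDu_def using that
    by (intro continuous_intros C(3-5) continuous_on_compose2[OF cr' cq] continuous_on_compose2[OF cr'' cq]) auto
  show "Ck_on 2 (\<lambda>x. ramp (u x \<bullet> u x - R\<^sup>2)) S"
    using Ck_on_2I(1)[OF \<open>open S\<close> d1 d2 c2] by (simp add: q_def)
  show "laplacian (\<lambda>x. ramp (u x \<bullet> u x - R\<^sup>2)) x \<ge> 0" if "x \<in> S"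
  proof -
    have "laplacian (\<lambda>x. ramp (q x)) x = (\<Sum>b\<in>Basis. w'' b x b)"
      using Ck_on_2I(2)[OF \<open>open S\<close> d1 d2 c2 that] by simp
    also have "\<dots> = (\<Sum>b\<in>Basis. ramp'' (q x) * (2 * (u x \<bullet> pd b u x))\<^sup>2 + 2 * ramp' (q x) * (pd b u x \<bullet> pd b u x))
        + 2 * ramp' (q x) * (u x \<bullet> laplacian u x)"
      by (simp add: w''_def Du_def DDu_def laplacian_def inner_sum_right sum_distrib_left sum.distrib[symmetric]
          power2_eq_square algebra_simps)
    also have "\<dots> \<ge> 0"
    proof -
      have "ramp' (q x) * (u x \<bullet> laplacian u x) \<ge> 0"
      proof (cases "q x \<le> 0")
        case True then show ?thesis by (simp add: ramp'_def)
      next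
        case False
        then have "R\<^sup>2 < (norm (u x))\<^sup>2" by (simp add: q_def dot_square_norm)
        then have "norm (u x) > R" by (rule power_less_imp_less_base) simp
        then show ?thesis using out[OF that] ramp'_nonneg by simp
      qed
      moreover have "(\<Sum>b\<in>Basis. ramp'' (q x) * (2 * (u x \<bullet> pd b u x))\<^sup>2 + 2 * ramp' (q x) * (pd b u x \<bullet> pd b u x)) \<ge> 0"
        using ramp'_nonneg ramp''_nonneg by (intro sum_nonneg add_nonneg_nonneg mult_nonneg_nonneg) auto
      ultimately show ?thesis by simp
    qed
    finally show ?thesis by (simp add: q_def)
  qed
qed

lemma Ck_on_2_inner:
  fixes u :: "'a::euclidean_space \<Rightarrow> 'b::euclidean_space"
  assumes C2: "Ck_on 2 u S" and "open S"
  shows "Ck_on 2 (\<lambda>x. u x \<bullet> v) S"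
    and "x \<in> S \<Longrightarrow> laplacian (\<lambda>x. u x \<bullet> v) x = laplacian u x \<bullet> v"
    and "x \<in> S \<Longrightarrow> pd b (\<lambda>x. u x \<bullet> v) x = pd b u x \<bullet> v"
proof -
  note C = Ck_on_2D[OF C2]
  have d1: "((\<lambda>x. u x \<bullet> v) has_derivative (\<lambda>h. frechet_derivative u (at x) h \<bullet> v)) (at x)" if "x \<in> S" for x
    using C(1)[OF that] by (intro has_derivative_inner_left) (simp add: frechet_derivative_works)
  have d2: "((\<lambda>x. pd b u x \<bullet> v) has_derivative (\<lambda>h. frechet_derivative (pd b u) (at x) h \<bullet> v)) (at x)"
    if "x \<in> S" "b \<in> Basis" for x b
    using C(2)[OF that] by (intro has_derivative_inner_left) (simp add: frechet_derivative_works)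
  have c: "continuous_on S (\<lambda>x. pd c (pd b u) x \<bullet> v)" if "b \<in> Basis" "c \<in> Basis" for b c
    using that by (intro continuous_intros C(3))
  show "Ck_on 2 (\<lambda>x. u x \<bullet> v) S"
    using Ck_on_2I(1)[OF \<open>open S\<close> d1 d2 c] by simp
  show "x \<in> S \<Longrightarrow> laplacian (\<lambda>x. u x \<bullet> v) x = laplacian u x \<bullet> v"
    using Ck_on_2I(2)[OF \<open>open S\<close> d1 d2 c] by (simp add: laplacian_def inner_sum_left)
  show "x \<in> S \<Longrightarrow> pd b (\<lambda>x. u x \<bullet> v) x = pd b u x \<bullet> v"
    using frechet_derivative_at[OF d1] by metis
qed

section \<open>The potential\<close>

lemma multiwell_potential_facts:
  assumes "multiwell_potential V"
  shows "Ck_on 2 V UNIV" and "0 \<le> V y" and "V differentiable (at y)"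
    and "(grad V has_derivative (\<lambda>v. \<Sum>b\<in>Basis. frechet_derivative (pd b V) (at y) v *\<^sub>R b)) (at y)"
    and "continuous_on UNIV V" and "continuous_on UNIV (grad V)"
    and "continuous_on UNIV (\<lambda>(y, v). v \<bullet> frechet_derivative (grad V) (at y) v)"
proof -
  show C2: "Ck_on 2 V UNIV" using assms by (simp add: multiwell_potential_def smooth_on_def)
  note C = Ck_on_2D[OF C2]
  show "0 \<le> V y"
    using assms cINF_lower[of V UNIV y] by (simp add: multiwell_potential_def)
  show "V differentiable (at y)" "continuous_on UNIV V" using C by auto
  have D: "(grad V has_derivative (\<lambda>v. \<Sum>b\<in>Basis. frechet_derivative (pd b V) (at y) v *\<^sub>R b)) (at y)" for y
    unfolding grad_def[abs_def] using C(2)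
    by (intro has_derivative_sum has_derivative_scaleR_left) (auto simp: frechet_derivative_works)
  then show "(grad V has_derivative (\<lambda>v. \<Sum>b\<in>Basis. frechet_derivative (pd b V) (at y) v *\<^sub>R b)) (at y)" .
  show "continuous_on UNIV (grad V)"
    unfolding grad_def[abs_def] by (intro continuous_intros C(4))
  \<comment> \<open>In terms of second partial derivatives the form is visibly continuous in y and v
    jointly, as the compactness argument on pairs requires.\<close>
  have *: "v \<bullet> frechet_derivative (grad V) (at y) v
      = (\<Sum>b\<in>Basis. \<Sum>c\<in>Basis. (v \<bullet> c) * pd c (pd b V) y * (v \<bullet> b))" for y v
  proof -
    have "frechet_derivative (pd b V) (at y) v = (\<Sum>c\<in>Basis. (v \<bullet> c) * pd c (pd b V) y)" if "b \<in> Basis" for b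
    proof -
      have lin: "linear (frechet_derivative (pd b V) (at y))"
        using C(2)[OF _ that] by (intro linear_frechet_derivative) auto
      have "frechet_derivative (pd b V) (at y) v = frechet_derivative (pd b V) (at y) (\<Sum>c\<in>Basis. (v \<bullet> c) *\<^sub>R c)"
        by (simp add: euclidean_representation)
      then show ?thesis by (simp add: linear_sum[OF lin] linear_cmul[OF lin])
    qed
    moreover have "frechet_derivative (grad V) (at y) = (\<lambda>v. \<Sum>b\<in>Basis. frechet_derivative (pd b V) (at y) v *\<^sub>R b)"
      using frechet_derivative_at[OF D] by simp
    ultimately show ?thesis by (simp add: inner_sum_right sum_distrib_right)
  qed
  show "continuous_on UNIV (\<lambda>(y, v). v \<bullet> frechet_derivative (grad V) (at y) v)"
    unfolding * split_beta
    by (intro continuous_intros continuous_on_compose2[OF C(3)]) auto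
qed

lemma inner_grad: "V differentiable (at y) \<Longrightarrow> v \<bullet> grad V y = frechet_derivative V (at y) v"
  using GDERIV_grad[of V y] by (metis frechet_derivative_at gderiv_def)

text \<open>Coercivity is integrated along the ray through y, from the sphere of radius R outwards:
  \<open>k\<close>, the potential minus its quadratic minorant, is at least as large at t = 1 as at
  t0 = R / |y|, where \<open>V\<close> is nonnegative.\<close>

lemma potential_quadratic_lower_bound:
  fixes V :: "'b::euclidean_space \<Rightarrow> real"
  assumes diff: "\<And>y. V differentiable (at y)" and pos: "\<And>y. 0 \<le> V y" and "\<alpha> > 0" "R > 0"
    and coer: "\<And>y. norm y > R \<Longrightarrow> y \<bullet> grad V y \<ge> \<alpha> * (norm y)\<^sup>2"
  shows "\<alpha> / 2 * ((norm y)\<^sup>2 - R\<^sup>2) \<le> V y"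
proof (cases "norm y > R")
  case False
  then have "(norm y)\<^sup>2 \<le> R\<^sup>2" by (intro power_mono) auto
  then have "\<alpha> / 2 * ((norm y)\<^sup>2 - R\<^sup>2) \<le> 0" using \<open>\<alpha> > 0\<close> by (intro mult_nonneg_nonpos) auto
  then show ?thesis using pos[of y] by linarith
next
  case True
  define t0 where "t0 = R / norm y"
  have y0: "norm y > 0" using True \<open>R > 0\<close> by linarith
  have t0: "0 < t0" "t0 < 1" using True \<open>R > 0\<close> y0 by (auto simp: t0_def)
  define k where "k t = V (0 + t *\<^sub>R y) - \<alpha> * (norm y)\<^sup>2 / 2 * t\<^sup>2" for t
  have "\<exists>t. t > t0 \<and> t < 1 \<and> k 1 - k t0 = (1 - t0) * (y \<bullet> grad V (t *\<^sub>R y) - \<alpha> * (norm y)\<^sup>2 * t)"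
  proof (rule MVT2[OF t0(2)])
    fix t
    have "((\<lambda>t. V (0 + t *\<^sub>R y)) has_real_derivative frechet_derivative V (at (t *\<^sub>R y)) y) (at t)"
      by (rule has_dd_DERIV) (simp add: has_dd_pd diff)
    then show "(k has_real_derivative y \<bullet> grad V (t *\<^sub>R y) - \<alpha> * (norm y)\<^sup>2 * t) (at t)"
      unfolding k_def inner_grad[OF diff] by (auto intro!: derivative_eq_intros)
  qed
  then obtain t where t: "t > t0" "t < 1"
    and eq: "k 1 - k t0 = (1 - t0) * (y \<bullet> grad V (t *\<^sub>R y) - \<alpha> * (norm y)\<^sup>2 * t)" by auto
  have "t > 0" using t t0 by linarith
  have "norm (t *\<^sub>R y) = t * norm y" using \<open>t > 0\<close> by simp
  moreover have "norm (t *\<^sub>R y) > R" using t y0 \<open>t > 0\<close> by (simp add: t0_def divide_less_eq)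
  ultimately have "\<alpha> * (t * norm y)\<^sup>2 \<le> t * (y \<bullet> grad V (t *\<^sub>R y))"
    using coer[of "t *\<^sub>R y"] by (simp only: inner_scaleR_left)
  then have "t * (\<alpha> * (norm y)\<^sup>2 * t) \<le> t * (y \<bullet> grad V (t *\<^sub>R y))"
    by (simp add: power2_eq_square mult_ac)
  then have "\<alpha> * (norm y)\<^sup>2 * t \<le> y \<bullet> grad V (t *\<^sub>R y)" using \<open>t > 0\<close> by simp
  then have "k 1 \<ge> k t0" using t0 eq by (smt (verit) mult_nonneg_nonneg)
  moreover have "k t0 \<ge> - (\<alpha> / 2 * R\<^sup>2)"
  proof -
    have "\<alpha> * (norm y)\<^sup>2 / 2 * t0\<^sup>2 = \<alpha> / 2 * R\<^sup>2" using y0 by (simp add: t0_def power_divide)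
    then show ?thesis using pos[of "0 + t0 *\<^sub>R y"] by (simp only: k_def)
  qed
  ultimately show ?thesis by (simp add: k_def algebra_simps)
qed

section \<open>Energy\<close>

lemma grad_norm2_nonneg: "0 \<le> grad_norm2 u x"
  by (simp add: grad_norm2_def sum_nonneg)

lemma energy_density_nonneg:
  assumes "\<And>y. 0 \<le> V y" "\<epsilon> > 0"
  shows "0 \<le> energy_density V \<epsilon> u x"
  using assms grad_norm2_nonneg[of u x] by (simp add: energy_density_def)

lemma continuous_on_energy_density:
  assumes "Ck_on 2 u \<Omega>" "continuous_on UNIV V"
  shows "continuous_on \<Omega> (energy_density V \<epsilon> u)"
  unfolding energy_density_def[abs_def] grad_norm2_def divide_inverse
  using Ck_on_2D[OF assms(1)] assms(2)
  by (intro continuous_intros continuous_on_compose2[OF assms(2)]) auto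

lemma energy_bound:
  fixes \<Omega> :: "'a::euclidean_space set"
  assumes "open \<Omega>" "Ck_on 2 u \<Omega>" "continuous_on UNIV V" and pos: "\<And>y. 0 \<le> V y" and "\<epsilon> > 0"
    and E: "energy \<Omega> V \<epsilon> u \<le> ennreal M" and "M \<ge> 0"
  shows "set_integrable lborel \<Omega> (energy_density V \<epsilon> u)"
    and "(LINT x:\<Omega>|lborel. energy_density V \<epsilon> u x) \<le> M"
proof -
  let ?e = "\<lambda>x. indicator \<Omega> x *\<^sub>R energy_density V \<epsilon> u x"
  have m: "?e \<in> borel_measurable lborel"
    using borel_measurable_continuous_on_indicator[OF _ continuous_on_energy_density[OF assms(2,3)], of \<epsilon>] \<open>open \<Omega>\<close>
    by simp
  have nn: "0 \<le> ?e x" for x using energy_density_nonneg[OF pos \<open>\<epsilon> > 0\<close>, where u = u and x = x] by simp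
  have eq: "(\<integral>\<^sup>+x. ennreal (?e x) \<partial>lborel) = energy \<Omega> V \<epsilon> u"
    unfolding energy_def by (intro nn_integral_cong) (auto split: split_indicator)
  have i: "integrable lborel ?e"
    using m nn eq E by (intro integrableI_nonneg) (auto simp: le_less_trans[OF _ ennreal_less_top])
  then show "set_integrable lborel \<Omega> (energy_density V \<epsilon> u)" by (simp add: set_integrable_def)
  have "ennreal (integral\<^sup>L lborel ?e) \<le> ennreal M"
    using nn_integral_eq_integral[OF i] nn eq E by simp
  then show "(LINT x:\<Omega>|lborel. energy_density V \<epsilon> u x) \<le> M"
    using \<open>M \<ge> 0\<close> by (simp add: set_lebesgue_integral_def ennreal_le_iff)
qed

section \<open>Interior bounds for solutions\<close>

text \<open>Coercivity gives the inner product of u with grad V(u) a sign for |u| > R, which is the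
  hypothesis of the truncation lemma. The linear growth of the truncation in |u|^2 matches the
  quadratic lower bound on \<open>V\<close>, and V(u) \<le> V(u) / \<epsilon> because \<epsilon>
  \<le> 1, so its integral over the cube is at most 2 M / \<alpha>, uniformly in \<epsilon> and
  u.\<close>

lemma solution_sup_bound:
  fixes \<Omega> :: "'a::euclidean_space set" and V :: "'b::euclidean_space \<Rightarrow> real"
  assumes "open \<Omega>" and V: "multiwell_potential V" and "M \<ge> 0" and "r > 0"
  shows "\<exists>B\<ge>0. \<forall>\<epsilon> u x. 0 < \<epsilon> \<and> \<epsilon> \<le> 1 \<and> solution_on \<Omega> V \<epsilon> u \<and> energy \<Omega> V \<epsilon> u \<le> ennreal M \<and>
    cbox (x - r *\<^sub>R One) (x + r *\<^sub>R One) \<subseteq> \<Omega> \<longrightarrow> norm (u x) \<le> B"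
proof -
  note Vf = multiwell_potential_facts[OF V]
  obtain \<alpha> R where aR: "\<alpha> > 0" "R > 0" and coer: "\<And>y. norm y > R \<Longrightarrow> y \<bullet> grad V y \<ge> \<alpha> * (norm y)\<^sup>2"
    using V unfolding multiwell_potential_def by blast
  note lower = potential_quadratic_lower_bound[OF Vf(3,2) aR coer]
  define I where "I = integral (cbox (- One) One) (\<lambda>z::'a. max 0 (1 - z \<bullet> z))"
  have I: "I > 0"
  proof -
    have c: "continuous_on (cbox (- One) One) (\<lambda>z::'a. max 0 (1 - z \<bullet> z))" by (intro continuous_intros)
    then have hi: "((\<lambda>z::'a. max 0 (1 - z \<bullet> z)) has_integral I) (cbox (- One) One)"
      unfolding I_def by (intro integrable_integral integrable_continuous)
    then have "I \<ge> 0" by (rule has_integral_nonneg) simp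
    moreover have "I \<noteq> 0"
    proof
      assume "I = 0"
      with hi have "((\<lambda>z::'a. max 0 (1 - z \<bullet> z)) has_integral 0) (cbox (- One) One)" by simp
      from has_integral_0_cbox_imp_0[OF c _ this, of 0] show False
        by (auto simp: mem_box box_ne_empty)
    qed
    ultimately show ?thesis by simp
  qed
  \<comment> \<open>The bound that the mean value inequality gives for the truncation at x. The
    summand 2 in the final radius is the loss in \<open>le_ramp\<close>.\<close>
  define K where "K = 2 / \<alpha> * M / r ^ DIM('a) / I"
  have K0: "K \<ge> 0" using I aR \<open>M \<ge> 0\<close> \<open>r > 0\<close> by (simp add: K_def)
  show ?thesis
  proof (intro exI[of _ "sqrt (R\<^sup>2 + K + 2)"] conjI allI impI)
    show "0 \<le> sqrt (R\<^sup>2 + K + 2)" using K0 by simp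
    fix \<epsilon> u x
    assume A: "0 < \<epsilon> \<and> \<epsilon> \<le> 1 \<and> solution_on \<Omega> V \<epsilon> u \<and> energy \<Omega> V \<epsilon> u \<le> ennreal M \<and>
      cbox (x - r *\<^sub>R One) (x + r *\<^sub>R One) \<subseteq> \<Omega>"
    then have eps: "0 < \<epsilon>" "\<epsilon> \<le> 1" and C2: "Ck_on 2 u \<Omega>"
      and eq: "\<And>x. x \<in> \<Omega> \<Longrightarrow> laplacian u x = (1 / \<epsilon>\<^sup>2) *\<^sub>R grad V (u x)"
      and box: "cbox (x - r *\<^sub>R One) (x + r *\<^sub>R One) \<subseteq> \<Omega>"
      by (auto simp: solution_on_def)
    define w where "w x = ramp (u x \<bullet> u x - R\<^sup>2)" for x
    let ?B = "cbox (x - r *\<^sub>R One) (x + r *\<^sub>R One)"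
    have out: "u y \<bullet> laplacian u y \<ge> 0" if "y \<in> \<Omega>" "norm (u y) > R" for y
    proof -
      have "0 \<le> \<alpha> * (norm (u y))\<^sup>2" using aR by simp
      then have "u y \<bullet> grad V (u y) \<ge> 0" using coer[OF that(2)] by linarith
      then show ?thesis by (simp add: eq[OF that(1)])
    qed
    have w: "Ck_on 2 w \<Omega>" "\<And>y. y \<in> \<Omega> \<Longrightarrow> laplacian w y \<ge> 0"
      unfolding w_def[abs_def] using subharmonic_ramp_norm[OF C2 \<open>open \<Omega>\<close> _ out] aR by auto
    have mv: "w x * I \<le> integral ?B w / r ^ DIM('a)"
      unfolding I_def by (rule subharmonic_mean_value[OF w(1) \<open>open \<Omega>\<close> w(2) _ \<open>r > 0\<close> box])
        (auto simp: w_def ramp_nonneg)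
    have w_le: "w y \<le> 2 / \<alpha> * energy_density V \<epsilon> u y" for y
    proof -
      have "w y \<le> max 0 ((norm (u y))\<^sup>2 - R\<^sup>2)" using ramp_le by (simp add: w_def dot_square_norm)
      also have "\<dots> \<le> 2 / \<alpha> * V (u y)"
        using lower[of "u y"] aR Vf(2)[of "u y"] by (simp add: field_simps)
      also have "\<dots> \<le> 2 / \<alpha> * energy_density V \<epsilon> u y"
      proof -
        have "V (u y) * \<epsilon> \<le> V (u y)" using eps Vf(2)[of "u y"] by (simp add: mult_left_le)
        then have "V (u y) \<le> 1 / \<epsilon> * V (u y)" using eps by (simp add: field_simps)
        also have "\<dots> \<le> energy_density V \<epsilon> u y"
          using eps grad_norm2_nonneg[of u y] by (simp add: energy_density_def)
        finally show ?thesis using aR by (intro mult_left_mono) auto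
      qed
      finally show ?thesis .
    qed
    have eb: "set_integrable lborel \<Omega> (energy_density V \<epsilon> u)" "(LINT x:\<Omega>|lborel. energy_density V \<epsilon> u x) \<le> M"
      using energy_bound[OF \<open>open \<Omega>\<close> C2 Vf(5,2)] eps A \<open>M \<ge> 0\<close> by auto
    have wi: "set_integrable lborel ?B w"
      unfolding set_integrable_def
      using continuous_on_subset[OF Ck_on_2D(5)[OF w(1)] box] by (intro borel_integrable_compact) auto
    have "integral ?B w = (LINT y:?B|lborel. w y)"
      using set_borel_integral_eq_integral(2)[OF wi] by simp
    also have "\<dots> \<le> (LINT y:\<Omega>|lborel. 2 / \<alpha> * energy_density V \<epsilon> u y)"
      unfolding set_lebesgue_integral_def
    proof (rule integral_mono)
      show "integrable lborel (\<lambda>y. indicator ?B y *\<^sub>R w y)" using wi by (simp add: set_integrable_def)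
      show "integrable lborel (\<lambda>y. indicator \<Omega> y *\<^sub>R (2 / \<alpha> * energy_density V \<epsilon> u y))"
        using set_integrable_mult_right[of "2 / \<alpha>" lborel \<Omega>, OF eb(1)] by (simp add: set_integrable_def)
      show "indicator ?B y *\<^sub>R w y \<le> indicator \<Omega> y *\<^sub>R (2 / \<alpha> * energy_density V \<epsilon> u y)" for y
        using box w_le[of y] energy_density_nonneg[OF Vf(2) eps(1), where u = u and x = y] aR
        by (auto split: split_indicator)
    qed
    also have "\<dots> = 2 / \<alpha> * (LINT y:\<Omega>|lborel. energy_density V \<epsilon> u y)"
      by (rule set_integral_mult_right)
    also have "\<dots> \<le> 2 / \<alpha> * M" using eb(2) aR by (intro mult_left_mono) auto
    finally have "integral ?B w / r ^ DIM('a) \<le> 2 / \<alpha> * M / r ^ DIM('a)"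
      using \<open>r > 0\<close> by (intro divide_right_mono) auto
    with mv have "w x * I \<le> 2 / \<alpha> * M / r ^ DIM('a)" by linarith
    then have "w x \<le> K" unfolding K_def using I by (simp only: pos_le_divide_eq)
    then have "u x \<bullet> u x \<le> R\<^sup>2 + K + 2" using le_ramp[of "u x \<bullet> u x - R\<^sup>2"] by (simp add: w_def)
    then show "norm (u x) \<le> sqrt (R\<^sup>2 + K + 2)" by (simp add: norm_eq_sqrt_inner)
  qed
qed

text \<open>On the ball of radius \<epsilon> r both terms of the scalar bound have order 1 /
  \<epsilon>: the sup bound divided by the radius, and the Laplacian, of order 1 / \<epsilon>^2,
  times the radius.\<close>

lemma solution_gradient_bound:
  fixes \<Omega> :: "'a::euclidean_space set" and V :: "'b::euclidean_space \<Rightarrow> real"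
  assumes "open \<Omega>" and V: "multiwell_potential V" and "B \<ge> 0" and "r > 0"
  shows "\<exists>C\<ge>0. \<forall>\<epsilon> u x b. 0 < \<epsilon> \<and> \<epsilon> \<le> 1 \<and> solution_on \<Omega> V \<epsilon> u \<and> b \<in> Basis \<and>
    cball x r \<subseteq> \<Omega> \<and> (\<forall>y\<in>cball x r. norm (u y) \<le> B) \<longrightarrow> norm (pd b u x) \<le> C / \<epsilon>"
proof -
  note Vf = multiwell_potential_facts[OF V]
  have "bounded (grad V ` cball 0 B)"
    using Vf(6) by (intro compact_imp_bounded compact_continuous_image) (auto intro: continuous_on_subset)
  then obtain G0 where "\<forall>z\<in>grad V ` cball 0 B. norm z \<le> G0" unfolding bounded_iff by blast
  then have G0: "\<And>y. norm y \<le> B \<Longrightarrow> norm (grad V y) \<le> G0" by auto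
  define G where "G = max G0 0"
  have G: "\<And>y. norm y \<le> B \<Longrightarrow> norm (grad V y) \<le> G" "G \<ge> 0" using G0 by (auto simp: G_def le_max_iff_disj)
  show ?thesis
  proof (intro exI[of _ "DIM('a) * B / r + G * r / 2"] conjI allI impI)
    show "0 \<le> DIM('a) * B / r + G * r / 2" using G \<open>B \<ge> 0\<close> \<open>r > 0\<close> by simp
    fix \<epsilon> u x and b :: 'a
    assume A: "0 < \<epsilon> \<and> \<epsilon> \<le> 1 \<and> solution_on \<Omega> V \<epsilon> u \<and> b \<in> Basis \<and>
      cball x r \<subseteq> \<Omega> \<and> (\<forall>y\<in>cball x r. norm (u y) \<le> B)"
    then have eps: "0 < \<epsilon>" "\<epsilon> \<le> 1" and C2: "Ck_on 2 u \<Omega>" and b: "b \<in> Basis"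
      and eq: "\<And>x. x \<in> \<Omega> \<Longrightarrow> laplacian u x = (1 / \<epsilon>\<^sup>2) *\<^sub>R grad V (u x)"
      and ball: "cball x r \<subseteq> \<Omega>" and B: "\<And>y. y \<in> cball x r \<Longrightarrow> norm (u y) \<le> B"
      by (auto simp: solution_on_def)
    have "\<epsilon> * r \<le> r" using eps \<open>r > 0\<close> by simp
    then have sub: "cball x (\<epsilon> * r) \<subseteq> cball x r" by (rule subset_cball)
    \<comment> \<open>Pairing \<open>u\<close> with the direction of its own partial derivative at x
      turns the norm of that vector into a scalar partial derivative. If the derivative is zero then
      v = 0, and the argument still applies.\<close>
    define v where "v = sgn (pd b u x)"
    have v: "norm v \<le> 1" by (simp add: v_def norm_sgn)
    have inner_le: "\<bar>y \<bullet> v\<bar> \<le> norm y" for y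
      using Cauchy_Schwarz_ineq2[of y v] mult_left_mono[OF v, of "norm y"] by simp
    note in_v = Ck_on_2_inner[OF C2 \<open>open \<Omega>\<close>, where v = v]
    have "pd b (\<lambda>x. u x \<bullet> v) x \<le> DIM('a) * B / (\<epsilon> * r) + (G / \<epsilon>\<^sup>2) * (\<epsilon> * r) / 2"
    proof (rule partial_derivative_bound[OF in_v(1) \<open>open \<Omega>\<close> _ _ _ _ b])
      show "\<epsilon> * r > 0" using eps \<open>r > 0\<close> by simp
      show "cball x (\<epsilon> * r) \<subseteq> \<Omega>" using sub ball by blast
      fix y assume y: "y \<in> cball x (\<epsilon> * r)"
      show "\<bar>u y \<bullet> v\<bar> \<le> B" using inner_le[of "u y"] B[of y] y sub by auto
      have "\<bar>laplacian u y \<bullet> v\<bar> \<le> norm (laplacian u y)" by (rule inner_le)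
      also have "\<dots> = norm (grad V (u y)) / \<epsilon>\<^sup>2" using y sub ball by (subst eq) auto
      also have "\<dots> \<le> G / \<epsilon>\<^sup>2" using y sub by (intro divide_right_mono G B) auto
      finally show "\<bar>laplacian (\<lambda>x. u x \<bullet> v) y\<bar> \<le> G / \<epsilon>\<^sup>2"
        using in_v(2)[OF subsetD[OF order_trans[OF sub ball] y]] by simp
    qed
    also have "pd b (\<lambda>x. u x \<bullet> v) x = norm (pd b u x)"
    proof -
      have "pd b (\<lambda>x. u x \<bullet> v) x = pd b u x \<bullet> v"
        using \<open>r > 0\<close> by (intro in_v(3) subsetD[OF ball]) simp
      then show ?thesis
        by (cases "pd b u x = 0") (simp_all add: v_def sgn_div_norm dot_square_norm power2_eq_square)
    qed
    also have "DIM('a) * B / (\<epsilon> * r) + (G / \<epsilon>\<^sup>2) * (\<epsilon> * r) / 2 = (DIM('a) * B / r + G * r / 2) / \<epsilon>"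
      using eps \<open>r > 0\<close> by (simp add: field_simps power2_eq_square)
    finally show "norm (pd b u x) \<le> (DIM('a) * B / r + G * r / 2) / \<epsilon>" .
  qed
qed

section \<open>Convexity of the potential near its zeros\<close>

text \<open>On unit vectors over the zeros of \<open>V\<close> in the ball the form has a positive
  lower bound by compactness. Where the form falls below half of that bound, \<open>V\<close> is
  bounded away from zero, again by compactness, so a large multiple of \<open>V\<close> compensates.
  The two cases need no explicit neighbourhoods of the wells.\<close>

lemma hessian_lower_bound:
  fixes V :: "'b::euclidean_space \<Rightarrow> real"
  assumes V: "multiwell_potential V"
  shows "\<exists>c>0. \<exists>C\<ge>0. \<forall>y v. norm y \<le> B \<longrightarrow>
    c * (norm v)\<^sup>2 \<le> v \<bullet> frechet_derivative (grad V) (at y) v + C * V y * (norm v)\<^sup>2"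
proof -
  note Vf = multiwell_potential_facts[OF V]
  define q where "q = (\<lambda>(y, v). v \<bullet> frechet_derivative (grad V) (at y) v)"
  have cq: "continuous_on UNIV q" using Vf(7) by (simp add: q_def)
  have pos: "q (y, v) > 0" if "V y = 0" "v \<noteq> 0" for y v
    using V that by (simp add: multiwell_potential_def q_def)
  define S where "S = cball (0::'b) B \<times> sphere (0::'b) 1"
  have S: "compact S" unfolding S_def by (intro compact_Times) auto
  have cV: "continuous_on UNIV (\<lambda>p::'b \<times> 'b. V (fst p))"
    by (intro continuous_on_compose2[OF Vf(5)] continuous_intros) auto
  have lower: "\<exists>m>0. \<forall>p\<in>T. m \<le> f p"
    if T: "compact T" and f: "continuous_on UNIV f" "\<And>p. p \<in> T \<Longrightarrow> f p > 0"
    for T and f :: "'b \<times> 'b \<Rightarrow> real"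
  proof (cases "T = {}")
    case True then show ?thesis by (auto intro: exI[of _ 1])
  next
    case False
    from continuous_attains_inf[OF T False continuous_on_subset[OF f(1)]] obtain p
      where "p \<in> T" "\<forall>q\<in>T. f p \<le> f q" by auto
    then show ?thesis using f(2) by blast
  qed
  have "compact (S \<inter> {p. V (fst p) = 0})"
    using S cV by (intro compact_Int_closed closed_Collect_eq) auto
  moreover have "q p > 0" if "p \<in> S \<inter> {p. V (fst p) = 0}" for p
    using that pos[of "fst p" "snd p"] by (force simp: S_def)
  ultimately obtain c1 where "c1 > 0" "\<forall>p\<in>S \<inter> {p. V (fst p) = 0}. c1 \<le> q p"
    using lower[OF _ cq] by blast
  then have c1: "c1 > 0" "\<And>p. p \<in> S \<Longrightarrow> V (fst p) = 0 \<Longrightarrow> c1 \<le> q p"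
    by simp_all
  \<comment> \<open>Half of c1, so that the closed condition \<open>q p \<le> c\<close> already
    excludes the zeros of \<open>V\<close>.\<close>
  define c where "c = c1 / 2"
  have c: "c > 0" using c1 by (simp add: c_def)
  have "compact (S \<inter> {p. q p \<le> c})"
    using S cq by (intro compact_Int_closed closed_Collect_le) auto
  moreover have "V (fst p) > 0" if "p \<in> S \<inter> {p. q p \<le> c}" for p
  proof -
    have "V (fst p) \<noteq> 0" using that c1(2)[of p] c1(1) by (auto simp: c_def)
    then show ?thesis using Vf(2)[of "fst p"] by simp
  qed
  ultimately obtain m where "m > 0" "\<forall>p\<in>S \<inter> {p. q p \<le> c}. m \<le> V (fst p)"
    using lower[OF _ cV] by blast
  then have m: "m > 0" "\<And>p. p \<in> S \<Longrightarrow> q p \<le> c \<Longrightarrow> m \<le> V (fst p)"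
    by simp_all
  have "bounded (q ` S)"
    using S cq by (intro compact_imp_bounded compact_continuous_image) (auto intro: continuous_on_subset)
  then obtain Q where Q: "\<And>p. p \<in> S \<Longrightarrow> \<bar>q p\<bar> \<le> Q" unfolding bounded_iff by auto
  \<comment> \<open>C m pays for the most negative possible value of the form, at worst - Q, and
    leaves the margin c.\<close>
  define C where "C = (max Q 0 + c) / m"
  have C: "C \<ge> 0" using c m by (simp add: C_def)
  have unit: "c \<le> q p + C * V (fst p)" if "p \<in> S" for p
  proof (cases "q p \<le> c")
    case True
    have "C * m \<le> C * V (fst p)" using m(2)[OF that True] C by (rule mult_left_mono)
    moreover have "C * m = max Q 0 + c" using m by (simp add: C_def)
    ultimately show ?thesis using Q[OF that] by (simp add: abs_le_iff max_def split: if_splits)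
  next
    case False
    have "0 \<le> C * V (fst p)" using C Vf(2) by (intro mult_nonneg_nonneg)
    then show ?thesis using False by linarith
  qed
  have "c * (norm v)\<^sup>2 \<le> v \<bullet> frechet_derivative (grad V) (at y) v + C * V y * (norm v)\<^sup>2"
    if "norm y \<le> B" for y v
  proof (cases "v = 0")
    case True
    then show ?thesis by simp
  next
    case False
    have "linear (frechet_derivative (grad V) (at y))"
      by (rule linear_frechet_derivative) (rule differentiableI, rule Vf(4))
    then have lin: "frechet_derivative (grad V) (at y) (t *\<^sub>R w) = t *\<^sub>R frechet_derivative (grad V) (at y) w" for t w
      by (rule linear_cmul)
    \<comment> \<open>Every term is homogeneous of degree two in v, so unit vectors decide.\<close>
    have "c * (norm v)\<^sup>2 \<le> (q (y, sgn v) + C * V y) * (norm v)\<^sup>2"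
      using unit[of "(y, sgn v)"] that False by (intro mult_right_mono) (auto simp: S_def norm_sgn)
    moreover have "q (y, sgn v) * (norm v)\<^sup>2 = q (y, norm v *\<^sub>R sgn v)"
      by (simp add: q_def lin power2_eq_square)
    moreover have "norm v *\<^sub>R sgn v = v" using False by (simp add: sgn_div_norm)
    ultimately show ?thesis by (simp add: q_def distrib_right)
  qed
  then show ?thesis using c C by blast
qed

section \<open>Energy estimates inside a cutoff\<close>

text \<open>The weight \<open>\<phi>\<close> dominates the derivatives of the cutoff up to the
  factor L, so every error term becomes an energy, or a plain integral, weighted by
  \<open>\<phi>\<close>. D bounds the position vector on K, which enters through the test field
  \<eta>(x) x.\<close>

locale cutoff_solution =
  fixes \<Omega> K :: "'a::euclidean_space set" and \<eta> \<phi> :: "'a \<Rightarrow> real" and \<eta>' :: "'a \<Rightarrow> 'a \<Rightarrow> real"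
    and L D :: real
    and V :: "'b::euclidean_space \<Rightarrow> real" and \<epsilon> :: real and u :: "'a \<Rightarrow> 'b"
  assumes open_\<Omega>: "open \<Omega>" and K: "compact K" "K \<subseteq> \<Omega>"
    and \<eta>_dd: "\<And>b x. b \<in> Basis \<Longrightarrow> has_dd \<eta> (\<eta>' b x) b x"
    and cont_\<eta>: "continuous_on UNIV \<eta>" and cont_\<eta>': "\<And>b. b \<in> Basis \<Longrightarrow> continuous_on UNIV (\<eta>' b)"
    and cont_\<phi>: "continuous_on UNIV \<phi>"
    and supp: "\<And>x. x \<notin> K \<Longrightarrow> \<eta> x = 0" "\<And>b x. x \<notin> K \<Longrightarrow> \<eta>' b x = 0" "\<And>x. x \<notin> K \<Longrightarrow> \<phi> x = 0"
    and \<eta>_nonneg: "\<And>x. 0 \<le> \<eta> x" and \<phi>_nonneg: "\<And>x. 0 \<le> \<phi> x" and L: "0 \<le> L"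
    and \<eta>'_le: "\<And>b x. b \<in> Basis \<Longrightarrow> \<bar>\<eta>' b x\<bar> \<le> L * \<phi> x"
    and D: "\<And>x. x \<in> K \<Longrightarrow> norm x \<le> D" "0 \<le> D"
    and V: "multiwell_potential V" and \<epsilon>: "0 < \<epsilon>"
    and sol: "solution_on \<Omega> V \<epsilon> u"
begin

lemmas Vf = multiwell_potential_facts[OF V]

lemma C2: "Ck_on 2 u \<Omega>" and eq: "x \<in> \<Omega> \<Longrightarrow> laplacian u x = (1 / \<epsilon>\<^sup>2) *\<^sub>R grad V (u x)"
  using sol by (auto simp: solution_on_def)

lemmas C = Ck_on_2D[OF C2]

abbreviation e where "e \<equiv> energy_density V \<epsilon> u"
abbreviation H where "H y \<equiv> frechet_derivative (grad V) (at y)"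

lemma e_nonneg: "0 \<le> e x"
  by (rule energy_density_nonneg[OF Vf(2) \<epsilon>])

lemma cont_e: "continuous_on \<Omega> e"
  by (rule continuous_on_energy_density[OF C2 Vf(5)])

lemma cont_grad_norm2: "continuous_on \<Omega> (grad_norm2 u)"
  unfolding grad_norm2_def[abs_def] using C(4) by (intro continuous_intros) auto

lemma cont_Vu: "continuous_on \<Omega> (\<lambda>x. V (u x))" "continuous_on \<Omega> (\<lambda>x. grad V (u x))"
  using continuous_on_compose2[OF Vf(5) C(5)] continuous_on_compose2[OF Vf(6) C(5)] by auto

lemma integrable_supp:
  assumes "continuous_on \<Omega> g" "\<And>x. x \<notin> K \<Longrightarrow> g x = (0::real)"
  shows "integrable lborel g"
proof -
  have "integrable lborel (\<lambda>x. indicator K x *\<^sub>R g x)"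
    using K assms(1) by (intro borel_integrable_compact) (auto intro: continuous_on_subset)
  moreover have "indicator K x *\<^sub>R g x = g x" for x
    using assms(2)[of x] by (cases "x \<in> K") simp_all
  ultimately show ?thesis by (simp only:)
qed

lemmas cont_on_\<Omega> = continuous_on_subset[OF cont_\<eta> subset_UNIV]
  continuous_on_subset[OF cont_\<eta>' subset_UNIV] continuous_on_subset[OF cont_\<phi> subset_UNIV]

lemma integrable_\<phi>: "integrable lborel \<phi>"
  by (intro integrable_supp cont_on_\<Omega> supp)

lemma integrable_\<eta>: "continuous_on \<Omega> g \<Longrightarrow> integrable lborel (\<lambda>x. \<eta> x * g x)"
  and integrable_\<phi>_mult: "continuous_on \<Omega> g \<Longrightarrow> integrable lborel (\<lambda>x. \<phi> x * g x)"
  by (auto intro!: integrable_supp continuous_intros cont_on_\<Omega> simp: supp)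

lemma u_dd: "x \<in> \<Omega> \<Longrightarrow> has_dd u (pd b u x) b x"
  by (intro has_dd_pd C(1))

lemma pd_dd: "x \<in> \<Omega> \<Longrightarrow> c \<in> Basis \<Longrightarrow> has_dd (pd c u) (pd b (pd c u) x) b x"
  by (intro has_dd_pd C(2))

lemma V_dd: "x \<in> \<Omega> \<Longrightarrow> has_dd (\<lambda>x. V (u x)) (pd b u x \<bullet> grad V (u x)) b x"
  using has_dd_compose[OF u_dd[of x b], of V "frechet_derivative V (at (u x))"] Vf(3)
  by (simp add: inner_grad frechet_derivative_works)

lemma grad_V_dd: "x \<in> \<Omega> \<Longrightarrow> has_dd (\<lambda>x. grad V (u x)) (H (u x) (pd b u x)) b x"
  using has_dd_compose[OF u_dd[of x b], of "grad V" "H (u x)"] differentiableI[OF Vf(4)]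
  by (simp add: frechet_derivative_works)

lemma e_dd:
  assumes "x \<in> \<Omega>"
  shows "has_dd e (\<epsilon> * (\<Sum>i\<in>Basis. pd i u x \<bullet> pd j (pd i u) x) + 1 / \<epsilon> * (pd j u x \<bullet> grad V (u x))) j x"
proof -
  have "has_dd (\<lambda>x. \<epsilon> / 2 * (\<Sum>i\<in>Basis. pd i u x \<bullet> pd i u x) + 1 / \<epsilon> * V (u x))
    (0 * (\<Sum>i\<in>Basis. pd i u x \<bullet> pd i u x) + \<epsilon> / 2 * (\<Sum>i\<in>Basis. pd j (pd i u) x \<bullet> pd i u x + pd i u x \<bullet> pd j (pd i u) x)
      + (0 * V (u x) + 1 / \<epsilon> * (pd j u x \<bullet> grad V (u x)))) j x"
    using assms by (intro dd_intros pd_dd V_dd)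
  moreover have "(\<lambda>x. \<epsilon> / 2 * (\<Sum>i\<in>Basis. pd i u x \<bullet> pd i u x) + 1 / \<epsilon> * V (u x)) = e"
    by (auto simp: energy_density_def grad_norm2_def power2_norm_eq_inner)
  ultimately show ?thesis
    by (simp add: inner_commute[of "pd j (pd _ u) x"] sum.distrib sum_distrib_left algebra_simps)
qed

lemma cont_e':
  "j \<in> Basis \<Longrightarrow> continuous_on \<Omega> (\<lambda>x. \<epsilon> * (\<Sum>i\<in>Basis. pd i u x \<bullet> pd j (pd i u) x) + 1 / \<epsilon> * (pd j u x \<bullet> grad V (u x)))"
  using C cont_Vu by (intro continuous_intros) auto

lemma pd_mult_le:
  assumes "i \<in> Basis" "j \<in> Basis"
  shows "norm (pd i u x) * norm (pd j u x) \<le> grad_norm2 u x"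
proof -
  have *: "(norm (pd i u x))\<^sup>2 \<le> grad_norm2 u x" if "i \<in> Basis" for i
    unfolding grad_norm2_def using that by (intro member_le_sum) auto
  have "2 * (norm (pd i u x) * norm (pd j u x)) \<le> (norm (pd i u x))\<^sup>2 + (norm (pd j u x))\<^sup>2"
    using sum_squares_bound[of "norm (pd i u x)" "norm (pd j u x)"] by simp
  then show ?thesis using *[OF assms(1)] *[OF assms(2)] by linarith
qed

lemma grad_norm2_le: "\<epsilon> * grad_norm2 u x \<le> 2 * e x"
  using \<epsilon> Vf(2)[of "u x"] by (simp add: energy_density_def)

text \<open>
  Pohozaev's identity, localized: the stress-energy tensor \<open>e \<delta>\<^sub>i\<^sub>j - \<epsilon> \<partial>\<^sub>i u \<bullet> \<partial>\<^sub>j u\<close> is divergence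
  free and in dimension two its trace is \<open>2 V(u) / \<epsilon>\<close>. It is tested with the vector field \<open>\<eta>(x) x\<close>.
\<close>

lemma potential_estimate:
  assumes dim: "DIM('a) = 2"
  shows "(\<integral>x. \<eta> x * (1 / \<epsilon> * V (u x)) \<partial>lborel) \<le> 5 * L * D * (\<integral>x. \<phi> x * e x \<partial>lborel)"
proof -
  define e' where "e' j x = \<epsilon> * (\<Sum>i\<in>Basis. pd i u x \<bullet> pd j (pd i u) x) + 1 / \<epsilon> * (pd j u x \<bullet> grad V (u x))" for j x
  \<comment> \<open>Component j of the stress-energy tensor contracted with the position vector;
    \<open>F'\<close> is its derivative along j, written out by the product rule.\<close>
  define F where "F j x = (x \<bullet> j) * e x - \<epsilon> * (\<Sum>i\<in>Basis. (x \<bullet> i) * (pd i u x \<bullet> pd j u x))" for j x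
  define F' where "F' j x = (j \<bullet> j) * e x + (x \<bullet> j) * e' j x
    - \<epsilon> * (\<Sum>i\<in>Basis. (j \<bullet> i) * (pd i u x \<bullet> pd j u x)
        + (x \<bullet> i) * (pd j (pd i u) x \<bullet> pd j u x + pd i u x \<bullet> pd j (pd j u) x))" for j x
  define g where "g j x = \<eta>' j x * F j x + \<eta> x * F' j x" for j x
  have ce': "continuous_on \<Omega> (e' j)" if "j \<in> Basis" for j
    unfolding e'_def[abs_def] using that by (rule cont_e')
  have cF: "continuous_on \<Omega> (F j)" "continuous_on \<Omega> (F' j)" if j: "j \<in> Basis" for j
    unfolding F_def[abs_def] F'_def[abs_def]
    by (intro continuous_on_diff continuous_on_mult continuous_on_sum continuous_on_inner
        continuous_on_add continuous_on_const continuous_on_id cont_e ce' C(3) C(4) j; assumption)+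
  have dF: "has_dd (F j) (F' j x) j x" if "x \<in> \<Omega>" "j \<in> Basis" for j x
  proof -
    have "has_dd (F j) (((j \<bullet> j) * e x + (x \<bullet> j) * e' j x)
      - (0 * (\<Sum>i\<in>Basis. (x \<bullet> i) * (pd i u x \<bullet> pd j u x))
      + \<epsilon> * (\<Sum>i\<in>Basis. (j \<bullet> i) * (pd i u x \<bullet> pd j u x)
        + (x \<bullet> i) * (pd j (pd i u) x \<bullet> pd j u x + pd i u x \<bullet> pd j (pd j u) x)))) j x"
      unfolding F_def[abs_def] e'_def using that by (intro dd_intros e_dd pd_dd)
    then show ?thesis by (simp add: F'_def)
  qed
  have g: "integrable lborel (g j)" "integral\<^sup>L lborel (g j) = 0" if j: "j \<in> Basis" for j
  proof -
    have "has_dd (\<lambda>x. \<eta> x * F j x) (g j x) j x" if "x \<in> \<Omega>" for x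
      unfolding g_def using that j by (intro has_dd_mult dF \<eta>_dd)
    moreover have "continuous_on \<Omega> (\<lambda>x. \<eta> x * F j x)" "continuous_on \<Omega> (g j)"
      unfolding g_def[abs_def] using j
      by (intro continuous_on_add continuous_on_mult cF cont_on_\<Omega>; assumption)+
    ultimately show "integrable lborel (g j)" "integral\<^sup>L lborel (g j) = 0"
      using integral_dd_zero[OF open_\<Omega> K, of "\<lambda>x. \<eta> x * F j x" "g j" j] supp by (auto simp: g_def)
  qed
  \<comment> \<open>Facts 1 and 2 give the trace, 2 e - \<epsilon> |grad u|^2 in dimension two.
    Facts 3 and 4 show that the divergence of the tensor contributes nothing: 3 by symmetry of
    second derivatives, 4 by the equation.\<close>
  have trace: "(\<Sum>j\<in>Basis. F' j x) = 2 * (1 / \<epsilon> * V (u x))" if x: "x \<in> \<Omega>" for x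
  proof -
    have 1: "(\<Sum>j\<in>(Basis :: 'a set). (j \<bullet> j) * e x) = 2 * e x"
      using dim by simp
    have 2: "(\<Sum>j\<in>Basis. \<Sum>i\<in>Basis. (j \<bullet> i) * (pd i u x \<bullet> pd j u x)) = grad_norm2 u x"
    proof -
      have "(\<Sum>i\<in>Basis. (j \<bullet> i) * (pd i u x \<bullet> pd j u x)) = (norm (pd j u x))\<^sup>2" if "j \<in> Basis" for j
        using that by (simp add: inner_Basis if_distrib[of "\<lambda>c. c * _"] power2_norm_eq_inner cong: if_cong)
      then show ?thesis by (simp add: grad_norm2_def)
    qed
    have 3: "(\<Sum>j\<in>Basis. \<Sum>i\<in>Basis. (x \<bullet> i) * (pd j (pd i u) x \<bullet> pd j u x))
        = (\<Sum>j\<in>Basis. (x \<bullet> j) * (\<Sum>i\<in>Basis. pd i u x \<bullet> pd j (pd i u) x))"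
    proof -
      have "(\<Sum>j\<in>Basis. \<Sum>i\<in>Basis. (x \<bullet> i) * (pd j (pd i u) x \<bullet> pd j u x))
          = (\<Sum>i\<in>Basis. \<Sum>j\<in>Basis. (x \<bullet> i) * (pd j (pd i u) x \<bullet> pd j u x))"
        by (rule sum.swap)
      also have "\<dots> = (\<Sum>i\<in>Basis. \<Sum>j\<in>Basis. (x \<bullet> i) * (pd j u x \<bullet> pd i (pd j u) x))"
        using pd_commute[OF C2 open_\<Omega> x] by (intro sum.cong refl) (simp add: inner_commute)
      finally show ?thesis by (simp add: sum_distrib_left)
    qed
    have 4: "\<epsilon> * (\<Sum>j\<in>Basis. \<Sum>i\<in>Basis. (x \<bullet> i) * (pd i u x \<bullet> pd j (pd j u) x))
        = (\<Sum>j\<in>Basis. (x \<bullet> j) * (1 / \<epsilon> * (pd j u x \<bullet> grad V (u x))))"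
    proof -
      have "(\<Sum>j\<in>Basis. \<Sum>i\<in>Basis. (x \<bullet> i) * (pd i u x \<bullet> pd j (pd j u) x))
          = (\<Sum>i\<in>Basis. \<Sum>j\<in>Basis. (x \<bullet> i) * (pd i u x \<bullet> pd j (pd j u) x))"
        by (rule sum.swap)
      also have "\<dots> = (\<Sum>i\<in>Basis. (x \<bullet> i) * (pd i u x \<bullet> laplacian u x))"
        by (simp add: laplacian_def inner_sum_right sum_distrib_left)
      finally show ?thesis
        using \<epsilon> by (simp add: eq[OF x] sum_distrib_left power2_eq_square field_simps)
    qed
    have "(\<Sum>j\<in>Basis. F' j x) = (\<Sum>j\<in>(Basis :: 'a set). (j \<bullet> j) * e x)
        - \<epsilon> * (\<Sum>j\<in>Basis. \<Sum>i\<in>Basis. (j \<bullet> i) * (pd i u x \<bullet> pd j u x))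
        + \<epsilon> * (\<Sum>j\<in>Basis. (x \<bullet> j) * (\<Sum>i\<in>Basis. pd i u x \<bullet> pd j (pd i u) x))
        - \<epsilon> * (\<Sum>j\<in>Basis. \<Sum>i\<in>Basis. (x \<bullet> i) * (pd j (pd i u) x \<bullet> pd j u x))
        + (\<Sum>j\<in>Basis. (x \<bullet> j) * (1 / \<epsilon> * (pd j u x \<bullet> grad V (u x))))
        - \<epsilon> * (\<Sum>j\<in>Basis. \<Sum>i\<in>Basis. (x \<bullet> i) * (pd i u x \<bullet> pd j (pd j u) x))"
      unfolding F'_def e'_def
      by (simp add: sum.distrib sum_subtractf sum_distrib_left distrib_left mult.left_commute)
    then show ?thesis
      unfolding 1 2 3 4 by (simp add: energy_density_def)
  qed
  \<comment> \<open>Each |F j| is at most D e plus 2 D \<epsilon> |grad u|^2, and \<epsilon> |grad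
    u|^2 is at most 2 e, hence 5 D e; the two coordinates make 10. The factor 2 in front of the
    potential later halves it to 5.\<close>
  have rem: "- (\<Sum>j\<in>Basis. \<eta>' j x * F j x) \<le> 10 * L * D * (\<phi> x * e x)" if x: "x \<in> K" for x
  proof -
    have F: "\<bar>F j x\<bar> \<le> 5 * D * e x" if j: "j \<in> Basis" for j
    proof -
      have xi: "\<bar>x \<bullet> i\<bar> \<le> D" if "i \<in> Basis" for i
        using Basis_le_norm[OF that, of x] D(1)[OF x] by linarith
      have "\<bar>(x \<bullet> j) * e x\<bar> \<le> D * e x"
        using xi[OF j] e_nonneg[of x] by (simp add: abs_mult mult_right_mono)
      moreover have "\<bar>\<Sum>i\<in>Basis. (x \<bullet> i) * (pd i u x \<bullet> pd j u x)\<bar> \<le> (\<Sum>i\<in>(Basis::'a set). D * grad_norm2 u x)"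
      proof (rule order_trans[OF sum_abs sum_mono])
        fix i :: 'a assume i: "i \<in> Basis"
        have "\<bar>pd i u x \<bullet> pd j u x\<bar> \<le> grad_norm2 u x"
          using Cauchy_Schwarz_ineq2[of "pd i u x" "pd j u x"] pd_mult_le[OF i j, of x] by linarith
        then show "\<bar>(x \<bullet> i) * (pd i u x \<bullet> pd j u x)\<bar> \<le> D * grad_norm2 u x"
          unfolding abs_mult using xi[OF i] D(2) by (intro mult_mono) auto
      qed
      then have "\<epsilon> * \<bar>\<Sum>i\<in>Basis. (x \<bullet> i) * (pd i u x \<bullet> pd j u x)\<bar> \<le> \<epsilon> * (2 * (D * grad_norm2 u x))"
        using \<epsilon> dim by (intro mult_left_mono) auto
      moreover have "\<epsilon> * (2 * (D * grad_norm2 u x)) = 2 * D * (\<epsilon> * grad_norm2 u x)" by simp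
      moreover have "2 * D * (\<epsilon> * grad_norm2 u x) \<le> 2 * D * (2 * e x)"
        using grad_norm2_le[of x] D(2) by (intro mult_left_mono) auto
      moreover have "\<bar>\<epsilon> * (\<Sum>i\<in>Basis. (x \<bullet> i) * (pd i u x \<bullet> pd j u x))\<bar>
          = \<epsilon> * \<bar>\<Sum>i\<in>Basis. (x \<bullet> i) * (pd i u x \<bullet> pd j u x)\<bar>"
        using \<epsilon> by (simp add: abs_mult)
      ultimately show ?thesis unfolding F_def by linarith
    qed
    have "- (\<Sum>j\<in>Basis. \<eta>' j x * F j x) \<le> (\<Sum>j\<in>(Basis::'a set). (L * \<phi> x) * (5 * D * e x))"
      unfolding sum_negf[symmetric]
    proof (rule sum_mono)
      fix j :: 'a assume j: "j \<in> Basis"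
      have "- (\<eta>' j x * F j x) \<le> \<bar>\<eta>' j x\<bar> * \<bar>F j x\<bar>"
        by (metis abs_ge_minus_self abs_mult)
      also have "\<dots> \<le> (L * \<phi> x) * (5 * D * e x)"
        using \<eta>'_le[OF j] F[OF j] L \<phi>_nonneg by (intro mult_mono) auto
      finally show "- (\<eta>' j x * F j x) \<le> (L * \<phi> x) * (5 * D * e x)" .
    qed
    then show ?thesis by (simp add: dim mult_ac)
  qed
  have "(\<integral>x. \<eta> x * (2 * (1 / \<epsilon> * V (u x))) \<partial>lborel) - (\<integral>x. (\<Sum>j\<in>Basis. g j x) \<partial>lborel)
      = (\<integral>x. \<eta> x * (2 * (1 / \<epsilon> * V (u x))) - (\<Sum>j\<in>Basis. g j x) \<partial>lborel)"
    using g cont_Vu by (intro Bochner_Integration.integral_diff[symmetric] integrable_\<eta> continuous_intros) auto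
  also have "\<dots> \<le> (\<integral>x. 10 * L * D * (\<phi> x * e x) \<partial>lborel)"
  proof (rule integral_mono)
    show "integrable lborel (\<lambda>x. \<eta> x * (2 * (1 / \<epsilon> * V (u x))) - (\<Sum>j\<in>Basis. g j x))"
      using g cont_Vu by (intro Bochner_Integration.integrable_diff integrable_\<eta> continuous_intros) auto
    show "integrable lborel (\<lambda>x. 10 * L * D * (\<phi> x * e x))"
      by (intro integrable_mult_right integrable_\<phi>_mult cont_e)
    fix x
    show "\<eta> x * (2 * (1 / \<epsilon> * V (u x))) - (\<Sum>j\<in>Basis. g j x) \<le> 10 * L * D * (\<phi> x * e x)"
    proof (cases "x \<in> K")
      case True
      have "(\<Sum>j\<in>Basis. g j x) = (\<Sum>j\<in>Basis. \<eta>' j x * F j x) + \<eta> x * (\<Sum>j\<in>Basis. F' j x)"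
        by (simp add: g_def sum.distrib sum_distrib_left)
      then show ?thesis using rem[OF True] trace[of x] True K by auto
    next
      case False
      then show ?thesis by (simp add: supp g_def)
    qed
  qed
  finally have "2 * (\<integral>x. \<eta> x * (1 / \<epsilon> * V (u x)) \<partial>lborel) \<le> 10 * L * D * (\<integral>x. \<phi> x * e x \<partial>lborel)"
    using g by (simp add: mult.left_commute[of _ 2])
  then show ?thesis by simp
qed

text \<open>
  The equation is tested with \<open>\<eta> \<nabla>V(u)\<close>. The Hessian of \<open>V\<close> controls the gradient where \<open>u\<close> is near
  the zero set of \<open>V\<close>; elsewhere \<open>V(u)\<close> is bounded below, and the bound \<open>C / \<epsilon>\<close> on the gradient suffices.
\<close>

lemma gradient_estimate:
  fixes c A B G P :: real
  assumes c: "c > 0" and A: "A \<ge> 0"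
    and hess: "\<And>y v. norm y \<le> B \<Longrightarrow> c * (norm v)\<^sup>2 \<le> v \<bullet> H y v + A * V y * (norm v)\<^sup>2"
    and B: "\<And>x. x \<in> K \<Longrightarrow> norm (u x) \<le> B"
    and G: "\<And>y. norm y \<le> B \<Longrightarrow> norm (grad V y) \<le> G"
    and P: "\<And>x b. x \<in> K \<Longrightarrow> b \<in> Basis \<Longrightarrow> norm (pd b u x) \<le> P / \<epsilon>"
  shows "c * (\<integral>x. \<eta> x * (\<epsilon> * grad_norm2 u x) \<partial>lborel)
    \<le> L * (\<integral>x. \<phi> x * e x \<partial>lborel) + DIM('a) * L * G\<^sup>2 * \<epsilon> * (\<integral>x. \<phi> x \<partial>lborel)
      + DIM('a) * A * P\<^sup>2 * (\<integral>x. \<eta> x * (1 / \<epsilon> * V (u x)) \<partial>lborel)"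
proof -
  \<comment> \<open>The divergence of this field is the inner product of the Laplacian of u with
    grad V(u), plus the Hessian form summed over the partial derivatives of u.\<close>
  define F where "F j x = pd j u x \<bullet> grad V (u x)" for j x
  define F' where "F' j x = pd j (pd j u) x \<bullet> grad V (u x) + pd j u x \<bullet> H (u x) (pd j u x)" for j x
  define g where "g j x = \<eta>' j x * F j x + \<eta> x * F' j x" for j x
  have cH: "continuous_on \<Omega> (\<lambda>x. pd j u x \<bullet> H (u x) (pd j u x))" if "j \<in> Basis" for j
    using continuous_on_compose2[OF Vf(7) continuous_on_Pair[OF C(5) C(4)[OF that]]] by simp
  have cF: "continuous_on \<Omega> (F j)" "continuous_on \<Omega> (F' j)" if "j \<in> Basis" for j
    unfolding F_def[abs_def] F'_def[abs_def] using that
    by (intro continuous_on_inner continuous_on_add C(3) C(4) cont_Vu cH; assumption)+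
  have dF: "has_dd (F j) (F' j x) j x" if "x \<in> \<Omega>" "j \<in> Basis" for j x
    unfolding F_def[abs_def] F'_def using that by (intro dd_intros pd_dd grad_V_dd)
  have g: "integrable lborel (g j)" "integral\<^sup>L lborel (g j) = 0" if j: "j \<in> Basis" for j
  proof -
    have "has_dd (\<lambda>x. \<eta> x * F j x) (g j x) j x" if "x \<in> \<Omega>" for x
      unfolding g_def using that j by (intro has_dd_mult dF \<eta>_dd)
    moreover have "continuous_on \<Omega> (\<lambda>x. \<eta> x * F j x)" "continuous_on \<Omega> (g j)"
      unfolding g_def[abs_def] using j
      by (intro continuous_on_add continuous_on_mult cF cont_on_\<Omega>; assumption)+
    ultimately show "integrable lborel (g j)" "integral\<^sup>L lborel (g j) = 0"
      using integral_dd_zero[OF open_\<Omega> K, of "\<lambda>x. \<eta> x * F j x" "g j" j] supp by (auto simp: g_def)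
  qed
  have ptw: "c * (\<eta> x * (\<epsilon> * grad_norm2 u x)) - \<epsilon> * (\<Sum>j\<in>Basis. g j x)
      \<le> L * (\<phi> x * e x) + DIM('a) * L * G\<^sup>2 * \<epsilon> * \<phi> x + DIM('a) * A * P\<^sup>2 * (\<eta> x * (1 / \<epsilon> * V (u x)))"
    if x: "x \<in> K" for x
  proof -
    have "x \<in> \<Omega>" using x K by blast
    have G0: "norm (grad V (u x)) \<le> G" using G B x by blast
    \<comment> \<open>Young's inequality separates a gradient energy, absorbed into \<phi> e, from a
      term with G^2 that is not controlled by the energy but keeps the factor \<epsilon>.\<close>
    have j1: "- (\<epsilon> * (\<eta>' j x * F j x)) \<le> L * \<phi> x * (\<epsilon> * (norm (pd j u x))\<^sup>2 / 2 + \<epsilon> * G\<^sup>2)" if j: "j \<in> Basis" for j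
    proof -
      have "\<bar>F j x\<bar> \<le> norm (pd j u x) * norm (grad V (u x))" unfolding F_def by (rule Cauchy_Schwarz_ineq2)
      also have "\<dots> \<le> norm (pd j u x) * G" using G0 by (intro mult_left_mono) auto
      also have "\<dots> \<le> (norm (pd j u x))\<^sup>2 / 2 + G\<^sup>2"
        using sum_squares_bound[of "norm (pd j u x)" G] zero_le_power2[of G] by linarith
      finally have "\<bar>\<eta>' j x\<bar> * \<bar>F j x\<bar> \<le> (L * \<phi> x) * ((norm (pd j u x))\<^sup>2 / 2 + G\<^sup>2)"
        using \<eta>'_le[OF j] L \<phi>_nonneg by (intro mult_mono) auto
      then have "- (\<eta>' j x * F j x) \<le> (L * \<phi> x) * ((norm (pd j u x))\<^sup>2 / 2 + G\<^sup>2)"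
        by (metis abs_ge_minus_self abs_mult order_trans)
      then have "\<epsilon> * (- (\<eta>' j x * F j x)) \<le> \<epsilon> * ((L * \<phi> x) * ((norm (pd j u x))\<^sup>2 / 2 + G\<^sup>2))"
        using \<epsilon> by (intro mult_left_mono) auto
      then show ?thesis by (simp add: algebra_simps)
    qed
    have "(\<Sum>j\<in>Basis. - (\<epsilon> * (\<eta>' j x * F j x))) \<le> (\<Sum>j\<in>Basis. L * \<phi> x * (\<epsilon> * (norm (pd j u x))\<^sup>2 / 2 + \<epsilon> * G\<^sup>2))"
      using j1 by (rule sum_mono)
    also have "\<dots> = L * \<phi> x * (\<epsilon> * grad_norm2 u x / 2) + DIM('a) * L * G\<^sup>2 * \<epsilon> * \<phi> x"
      by (simp add: grad_norm2_def sum.distrib sum_distrib_left sum_divide_distrib algebra_simps)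
    also have "L * \<phi> x * (\<epsilon> * grad_norm2 u x / 2) \<le> L * \<phi> x * e x"
      using grad_norm2_le[of x] L \<phi>_nonneg by (intro mult_left_mono) auto
    finally have 1: "(\<Sum>j\<in>Basis. - (\<epsilon> * (\<eta>' j x * F j x))) \<le> L * \<phi> x * e x + DIM('a) * L * G\<^sup>2 * \<epsilon> * \<phi> x"
      by simp
    \<comment> \<open>After multiplication by \<epsilon>, V(u) (P / \<epsilon>)^2 becomes P^2 times
      the potential energy density V(u) / \<epsilon>: the gradient bound has just the right
      order.\<close>
    have j2: "c * (norm (pd j u x))\<^sup>2 \<le> pd j u x \<bullet> H (u x) (pd j u x) + A * V (u x) * (P / \<epsilon>)\<^sup>2"
      if j: "j \<in> Basis" for j
    proof -
      have "(norm (pd j u x))\<^sup>2 \<le> (P / \<epsilon>)\<^sup>2" using P[OF x j] by (intro power_mono) auto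
      then have "A * V (u x) * (norm (pd j u x))\<^sup>2 \<le> A * V (u x) * (P / \<epsilon>)\<^sup>2"
        using A Vf(2) by (intro mult_left_mono mult_nonneg_nonneg)
      then show ?thesis using hess[OF B[OF x], of "pd j u x"] by linarith
    qed
    have "c * grad_norm2 u x \<le> (\<Sum>j\<in>Basis. pd j u x \<bullet> H (u x) (pd j u x) + A * V (u x) * (P / \<epsilon>)\<^sup>2)"
      unfolding grad_norm2_def sum_distrib_left using j2 by (rule sum_mono)
    also have "\<dots> = (\<Sum>j\<in>Basis. pd j u x \<bullet> H (u x) (pd j u x)) + DIM('a) * A * V (u x) * (P / \<epsilon>)\<^sup>2"
      by (simp add: sum.distrib)
    \<comment> \<open>By the equation the difference of the two sides is |grad V(u)|^2 /
      \<epsilon>^2.\<close>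
    also have "(\<Sum>j\<in>Basis. pd j u x \<bullet> H (u x) (pd j u x)) \<le> (\<Sum>j\<in>Basis. F' j x)"
    proof -
      have "(\<Sum>j\<in>Basis. F' j x) = laplacian u x \<bullet> grad V (u x) + (\<Sum>j\<in>Basis. pd j u x \<bullet> H (u x) (pd j u x))"
        by (simp add: F'_def sum.distrib laplacian_def inner_sum_left)
      moreover have "laplacian u x \<bullet> grad V (u x) \<ge> 0" using \<open>x \<in> \<Omega>\<close> by (simp add: eq)
      ultimately show ?thesis by linarith
    qed
    finally have "c * grad_norm2 u x \<le> (\<Sum>j\<in>Basis. F' j x) + DIM('a) * A * V (u x) * (P / \<epsilon>)\<^sup>2" by simp
    then have "(\<eta> x * \<epsilon>) * (c * grad_norm2 u x) \<le> (\<eta> x * \<epsilon>) * ((\<Sum>j\<in>Basis. F' j x) + DIM('a) * A * V (u x) * (P / \<epsilon>)\<^sup>2)"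
      using \<eta>_nonneg \<epsilon> by (intro mult_left_mono) auto
    moreover have "(\<eta> x * \<epsilon>) * (DIM('a) * A * V (u x) * (P / \<epsilon>)\<^sup>2) = DIM('a) * A * P\<^sup>2 * (\<eta> x * (1 / \<epsilon> * V (u x)))"
      using \<epsilon> by (simp add: power2_eq_square field_simps)
    moreover have "\<epsilon> * (\<Sum>j\<in>Basis. g j x) = - (\<Sum>j\<in>Basis. - (\<epsilon> * (\<eta>' j x * F j x))) + \<eta> x * \<epsilon> * (\<Sum>j\<in>Basis. F' j x)"
      by (simp add: g_def sum.distrib sum_distrib_left sum_negf algebra_simps)
    ultimately show ?thesis using 1 by (simp add: algebra_simps)
  qed
  have "c * (\<integral>x. \<eta> x * (\<epsilon> * grad_norm2 u x) \<partial>lborel) - \<epsilon> * (\<integral>x. (\<Sum>j\<in>Basis. g j x) \<partial>lborel)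
      = (\<integral>x. c * (\<eta> x * (\<epsilon> * grad_norm2 u x)) - \<epsilon> * (\<Sum>j\<in>Basis. g j x) \<partial>lborel)"
    using g cont_grad_norm2
    by (subst Bochner_Integration.integral_diff)
      (auto intro!: integrable_mult_right integrable_\<eta> continuous_intros simp del: mult_cancel_left)
  also have "\<dots> \<le> (\<integral>x. L * (\<phi> x * e x) + DIM('a) * L * G\<^sup>2 * \<epsilon> * \<phi> x + DIM('a) * A * P\<^sup>2 * (\<eta> x * (1 / \<epsilon> * V (u x))) \<partial>lborel)"
  proof (rule integral_mono)
    show "integrable lborel (\<lambda>x. c * (\<eta> x * (\<epsilon> * grad_norm2 u x)) - \<epsilon> * (\<Sum>j\<in>Basis. g j x))"
      using g cont_grad_norm2
      by (intro Bochner_Integration.integrable_diff integrable_mult_right integrable_\<eta> continuous_intros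
          Bochner_Integration.integrable_sum) auto
    show "integrable lborel (\<lambda>x. L * (\<phi> x * e x) + DIM('a) * L * G\<^sup>2 * \<epsilon> * \<phi> x + DIM('a) * A * P\<^sup>2 * (\<eta> x * (1 / \<epsilon> * V (u x))))"
      using cont_e cont_Vu
      by (intro Bochner_Integration.integrable_add integrable_mult_right integrable_\<eta> integrable_\<phi>_mult integrable_\<phi> continuous_intros)
    show "c * (\<eta> x * (\<epsilon> * grad_norm2 u x)) - \<epsilon> * (\<Sum>j\<in>Basis. g j x)
        \<le> L * (\<phi> x * e x) + DIM('a) * L * G\<^sup>2 * \<epsilon> * \<phi> x + DIM('a) * A * P\<^sup>2 * (\<eta> x * (1 / \<epsilon> * V (u x)))" for x
      using ptw[of x] by (cases "x \<in> K") (auto simp: supp g_def)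
  qed
  also have "\<dots> = L * (\<integral>x. \<phi> x * e x \<partial>lborel) + DIM('a) * L * G\<^sup>2 * \<epsilon> * (\<integral>x. \<phi> x \<partial>lborel)
      + DIM('a) * A * P\<^sup>2 * (\<integral>x. \<eta> x * (1 / \<epsilon> * V (u x)) \<partial>lborel)"
  proof -
    have lin: "(\<integral>x. a * f x + b * g x + d * h x \<partial>lborel)
        = a * (\<integral>x. f x \<partial>lborel) + b * (\<integral>x. g x \<partial>lborel) + d * (\<integral>x. h x \<partial>lborel)"
      if "integrable lborel f" "integrable lborel g" "integrable lborel h"
      for a b d :: real and f g h :: "'a \<Rightarrow> real"
      using that by simp
    show ?thesis
      using cont_Vu(1)
      by (intro lin integrable_\<phi>_mult[OF cont_e] integrable_\<phi> integrable_\<eta> continuous_intros)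
  qed
  finally show ?thesis using g by simp
qed

lemma energy_split:
  "(\<integral>x. \<eta> x * e x \<partial>lborel)
    = 1 / 2 * (\<integral>x. \<eta> x * (\<epsilon> * grad_norm2 u x) \<partial>lborel) + (\<integral>x. \<eta> x * (1 / \<epsilon> * V (u x)) \<partial>lborel)"
proof -
  have i: "integrable lborel (\<lambda>x. \<eta> x * (\<epsilon> * grad_norm2 u x))" "integrable lborel (\<lambda>x. \<eta> x * (1 / \<epsilon> * V (u x)))"
    using cont_grad_norm2 cont_Vu by (intro integrable_\<eta> continuous_intros; simp)+
  have "(\<integral>x. \<eta> x * e x \<partial>lborel)
      = (\<integral>x. 1 / 2 * (\<eta> x * (\<epsilon> * grad_norm2 u x)) + \<eta> x * (1 / \<epsilon> * V (u x)) \<partial>lborel)"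
    by (simp add: energy_density_def algebra_simps)
  also have "\<dots> = 1 / 2 * (\<integral>x. \<eta> x * (\<epsilon> * grad_norm2 u x) \<partial>lborel) + (\<integral>x. \<eta> x * (1 / \<epsilon> * V (u x)) \<partial>lborel)"
    using Bochner_Integration.integral_add[OF integrable_mult_right[of "1 / 2", OF i(1)] i(2)] by simp
  finally show ?thesis .
qed

end

section \<open>Cutoff functions\<close>

text \<open>The derivatives are carried along as explicit functions and are required to vanish on
  all of A and from distance s on, so that they live in the transition layer only.\<close>

definition C1_cutoff ::
  "'a::euclidean_space set \<Rightarrow> real \<Rightarrow> ('a \<Rightarrow> real) \<Rightarrow> ('a \<Rightarrow> 'a \<Rightarrow> real) \<Rightarrow> real \<Rightarrow> bool" where
  "C1_cutoff A s \<eta> \<eta>' L \<longleftrightarrow>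
    (\<forall>b x. has_dd \<eta> (\<eta>' b x) b x) \<and> continuous_on UNIV \<eta> \<and> (\<forall>b. continuous_on UNIV (\<eta>' b)) \<and>
    (\<forall>x. 0 \<le> \<eta> x \<and> \<eta> x \<le> 1) \<and> (\<forall>x\<in>A. \<eta> x = 1 \<and> (\<forall>b. \<eta>' b x = 0)) \<and>
    (\<forall>x. s \<le> infdist x A \<longrightarrow> \<eta> x = 0 \<and> (\<forall>b. \<eta>' b x = 0)) \<and>
    0 \<le> L \<and> (\<forall>b\<in>Basis. \<forall>x. \<bar>\<eta>' b x\<bar> \<le> L)"

text \<open>The distance to A need not be differentiable. It is replaced by \<open>S\<close>, a
  finite sum of squared positive parts of s^2 - |x - a|^2 over an s/2-net of A: zero at distance at
  least s, and at least c on A. The profile 1 - (max 0 (c - S))^2 / c^2 is C^1 and rises from 0 at S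
  = 0 to 1 for S \<ge> c.\<close>

lemma C1_cutoff_exists:
  fixes A :: "'a::euclidean_space set"
  assumes A: "compact A" "A \<noteq> {}" and s: "s > 0"
  shows "\<exists>\<eta> \<eta>' L. C1_cutoff A s \<eta> \<eta>' L"
proof -
  obtain C where C: "finite C" "C \<subseteq> A" "A \<subseteq> (\<Union>a\<in>C. ball a (s / 2))"
  proof -
    have "A \<subseteq> (\<Union>a\<in>A. ball a (s / 2))" using s by auto
    from compactE_image[OF A(1) _ this] that show ?thesis by (metis open_ball)
  qed
  define p where "p a x = s\<^sup>2 - (x - a) \<bullet> (x - a)" for a x :: 'a
  define S where "S x = (\<Sum>a\<in>C. (max 0 (p a x))\<^sup>2)" for x
  define S' where "S' b x = (\<Sum>a\<in>C. 2 * max 0 (p a x) * (- 2 * ((x - a) \<bullet> b)))" for b x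
  \<comment> \<open>A point of A is within s/2 of some net point, whose term is at least (s^2 -
    (s/2)^2)^2.\<close>
  define c where "c = (3 / 4 * s\<^sup>2)\<^sup>2"
  define \<eta> where "\<eta> x = 1 - 1 / c\<^sup>2 * (max 0 (c - S x))\<^sup>2" for x
  define \<eta>' where "\<eta>' b x = 1 / c\<^sup>2 * (2 * max 0 (c - S x) * S' b x)" for b x
  have c: "c > 0" using s by (simp add: c_def)
  have S_nonneg: "0 \<le> S x" for x unfolding S_def by (intro sum_nonneg) auto
  have dp: "has_dd (p a) (- 2 * ((x - a) \<bullet> b)) b x" for a b x
  proof -
    have "((\<lambda>x. x - a) has_derivative (\<lambda>v. v)) (at x)" by (auto intro!: derivative_eq_intros)
    then have "has_dd (\<lambda>x. x - a) b b x" by (rule has_dd_has_derivative)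
    then have "has_dd (p a) (0 - (b \<bullet> (x - a) + (x - a) \<bullet> b)) b x"
      unfolding p_def[abs_def] by (intro has_dd_diff has_dd_const has_dd_inner)
    then show ?thesis by (simp add: inner_commute)
  qed
  have dS: "has_dd S (S' b x) b x" for b x
    unfolding S_def[abs_def] S'_def by (intro has_dd_sum has_dd_max_0_square dp)
  have d\<eta>: "has_dd \<eta> (\<eta>' b x) b x" for b x
  proof -
    have "has_dd \<eta> (0 - (0 * (max 0 (c - S x))\<^sup>2 + 1 / c\<^sup>2 * (2 * max 0 (c - S x) * (0 - S' b x)))) b x"
      unfolding \<eta>_def[abs_def]
      by (intro has_dd_diff has_dd_mult has_dd_const has_dd_max_0_square dS)
    then show ?thesis by (simp add: \<eta>'_def)
  qed
  have cp: "continuous_on UNIV (p a)" for a unfolding p_def[abs_def] by (intro continuous_intros)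
  have cS: "continuous_on UNIV S" "continuous_on UNIV (S' b)" for b
    unfolding S_def[abs_def] S'_def[abs_def] by (intro continuous_intros cp)+
  have c\<eta>: "continuous_on UNIV \<eta>" "continuous_on UNIV (\<eta>' b)" for b
    unfolding \<eta>_def[abs_def] \<eta>'_def[abs_def] by (intro continuous_intros cS)+
  have range: "0 \<le> \<eta> x \<and> \<eta> x \<le> 1" for x
  proof -
    have "(max 0 (c - S x))\<^sup>2 \<le> c\<^sup>2" using S_nonneg[of x] c by (intro power_mono) auto
    then show ?thesis using c by (simp add: \<eta>_def divide_le_eq)
  qed
  have inside: "\<eta> x = 1 \<and> (\<forall>b. \<eta>' b x = 0)" if x: "x \<in> A" for x
  proof -
    obtain a where a: "a \<in> C" "x \<in> ball a (s / 2)" using C(3) x by blast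
    then have "(norm (x - a))\<^sup>2 \<le> (s / 2)\<^sup>2"
      by (intro power_mono) (auto simp: dist_norm norm_minus_commute)
    then have "3 / 4 * s\<^sup>2 \<le> p a x" by (simp add: p_def dot_square_norm power_divide)
    then have "c \<le> (max 0 (p a x))\<^sup>2" unfolding c_def by (intro power_mono) auto
    also have "\<dots> \<le> S x" unfolding S_def using C(1) a(1) by (intro member_le_sum) auto
    finally show ?thesis by (simp add: \<eta>_def \<eta>'_def max_def)
  qed
  have outside: "\<eta> x = 0 \<and> (\<forall>b. \<eta>' b x = 0)" if "infdist x A \<ge> s" for x
  proof -
    have "max 0 (p a x) = 0" if "a \<in> C" for a
    proof -
      have "s \<le> norm (x - a)"
        using infdist_le[of a A x] C(2) that \<open>infdist x A \<ge> s\<close> by (auto simp: dist_norm)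
      then have "s\<^sup>2 \<le> (norm (x - a))\<^sup>2" using s by (intro power_mono) auto
      then show ?thesis by (simp add: p_def dot_square_norm)
    qed
    then have "S x = 0" "S' b x = 0" for b by (simp_all add: S_def S'_def)
    then show ?thesis using c by (simp add: \<eta>_def \<eta>'_def)
  qed
  have "compact {x. infdist x A \<le> s}" using A s by (intro compact_infdist_le)
  then have "bounded ((\<lambda>x. \<Sum>b\<in>Basis. \<bar>\<eta>' b x\<bar>) ` {x. infdist x A \<le> s})"
    by (intro compact_imp_bounded compact_continuous_image continuous_intros
        continuous_on_subset[OF c\<eta>(2) subset_UNIV])
  then obtain L where L: "\<And>x. infdist x A \<le> s \<Longrightarrow> \<bar>\<Sum>b\<in>Basis. \<bar>\<eta>' b x\<bar>\<bar> \<le> L"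
    unfolding bounded_iff by auto
  have "\<bar>\<eta>' b x\<bar> \<le> max L 0" if "b \<in> Basis" for b x
  proof (cases "infdist x A \<le> s")
    case True
    have "\<bar>\<eta>' b x\<bar> \<le> (\<Sum>b\<in>Basis. \<bar>\<eta>' b x\<bar>)" using that by (intro member_le_sum) auto
    then show ?thesis using L[OF True] by linarith
  qed (use outside in simp)
  then show ?thesis
    using d\<eta> c\<eta> range inside outside unfolding C1_cutoff_def
    by (intro exI[of _ \<eta>] exI[of _ \<eta>'] exI[of _ "max L 0"]) auto
qed

section \<open>Integration against energy measures\<close>

text \<open>Weak convergence speaks of measures on \<open>\<Omega>\<close>, the estimates of
  Lebesgue integrals over the whole space. As \<phi> vanishes off \<open>\<Omega>\<close>, the
  arbitrary values of u there do not matter.\<close>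

lemma integral_energy_measure:
  fixes \<Omega> :: "'a::euclidean_space set" and \<phi> :: "'a \<Rightarrow> real"
  assumes "open \<Omega>" "Ck_on 2 u \<Omega>" "continuous_on UNIV V" and pos: "\<And>y. 0 \<le> V y" and "\<epsilon> > 0"
    and \<phi>: "continuous_on UNIV \<phi>" "\<And>x. x \<notin> \<Omega> \<Longrightarrow> \<phi> x = 0"
  shows "(\<integral>x. \<phi> x \<partial>energy_measure \<Omega> V \<epsilon> u) = (\<integral>x. \<phi> x * energy_density V \<epsilon> u x \<partial>lborel)"
proof -
  let ?e = "energy_density V \<epsilon> u"
  have sets: "sets (restrict_space lborel \<Omega>) = sets (restrict_space borel \<Omega>)"
    by (rule sets_restrict_space_cong) simp
  have m: "f \<in> borel_measurable (restrict_space lborel \<Omega>)" if "continuous_on \<Omega> f" for f :: "'a \<Rightarrow> real"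
    using borel_measurable_continuous_on_restrict[OF that] measurable_cong_sets[OF sets refl] by blast
  have "(\<integral>x. \<phi> x \<partial>energy_measure \<Omega> V \<epsilon> u) = (\<integral>x. ?e x *\<^sub>R \<phi> x \<partial>restrict_space lborel \<Omega>)"
    unfolding energy_measure_def
    using continuous_on_energy_density[OF assms(2,3)] \<phi>(1)
    by (intro integral_density m AE_I2 energy_density_nonneg[OF pos \<open>\<epsilon> > 0\<close>])
      (auto intro: continuous_on_subset)
  also have "\<dots> = (\<integral>x. indicator \<Omega> x *\<^sub>R (?e x *\<^sub>R \<phi> x) \<partial>lborel)"
    using \<open>open \<Omega>\<close> by (intro integral_restrict_space) auto
  also have "\<dots> = (\<integral>x. \<phi> x * ?e x \<partial>lborel)"
    using \<phi>(2) by (intro Bochner_Integration.integral_cong) (auto split: split_indicator)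
  finally show ?thesis .
qed

section \<open>Vanishing of the limit measure\<close>

text \<open>The energy weighted by the cutoff is at most a fixed multiple of the energy weighted by
  \<open>\<phi>\<close> plus a fixed multiple of \<epsilon>. In the limit the former dominates the
  mass of the closure of U, and the latter is zero because \<open>\<phi>\<close> is nonzero only in
  the null collar.\<close>

lemma limit_energy_vanishes:
  fixes \<Omega> U :: "'a::euclidean_space set" and V :: "'b::euclidean_space \<Rightarrow> real"
    and \<epsilon> :: "nat \<Rightarrow> real" and u :: "nat \<Rightarrow> 'a \<Rightarrow> 'b" and M \<delta> :: real
  assumes dim: "DIM('a) = 2"
    and \<Omega>: "open \<Omega>" "bounded \<Omega>" and V: "multiwell_potential V" and M: "M \<ge> 0"
    and eps: "\<And>n. 0 < \<epsilon> n \<and> \<epsilon> n \<le> 1" "\<epsilon> \<longlonglongrightarrow> 0"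
    and sol: "\<And>n. solution_on \<Omega> V (\<epsilon> n) (u n)"
    and en: "\<And>n. energy \<Omega> V (\<epsilon> n) (u n) \<le> ennreal M"
    and \<nu>: "radon_measure_on \<Omega> \<nu>"
    and conv: "converges_as_measures_on \<Omega> (\<lambda>n. energy_measure \<Omega> V (\<epsilon> n) (u n)) \<nu>"
    and U: "closure U \<subseteq> \<Omega>" and "\<delta> > 0"
    and null: "collar \<Omega> U \<delta> \<in> sets \<nu>" "emeasure \<nu> (collar \<Omega> U \<delta>) = 0"
  shows "emeasure \<nu> (closure U) = 0"
proof (cases "U = {}")
  case True
  then show ?thesis by simp
next
  case False
  note Vf = multiwell_potential_facts[OF V]
  define cU where "cU = closure U"
  have cU: "compact cU" "cU \<noteq> {}" "cU \<subseteq> \<Omega>" "U \<subseteq> cU"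
    using U \<Omega>(2) False closure_subset[of U]
    by (auto simp: cU_def compact_eq_bounded_closed intro: bounded_subset)
  obtain e0 where e0: "e0 > 0" "{x. infdist x cU \<le> e0} \<subseteq> \<Omega>"
    using compact_in_open_separated[OF cU(2,1) \<Omega>(1) cU(3)] by metis
  \<comment> \<open>Five layers of width s around the closure of U: \<eta> is 1 up to distance s and
    0 from 2 s on; \<phi> vanishes from 3 s on; the gradient bound up to 3 s uses the bound on u up
    to 4 s, and that one uses cubes reaching up to 5 s inside \<open>\<Omega>\<close>.\<close>
  define s where "s = min \<delta> e0 / 5"
  have s: "s > 0" "5 * s \<le> \<delta>" "5 * s \<le> e0" using e0 \<open>\<delta> > 0\<close> by (auto simp: s_def min_def)
  define d where "d x = infdist x cU" for x
  have d_nonneg: "0 \<le> d x" for x by (simp add: d_def infdist_nonneg)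
  have d_tri: "d x \<le> d y + dist x y" for x y unfolding d_def by (rule infdist_triangle)
  have cont_d: "continuous_on A d" for A unfolding d_def[abs_def] by (intro continuous_intros)
  have comp: "compact {x. d x \<le> t}" if "t > 0" for t
    unfolding d_def using cU that by (intro compact_infdist_le)
  have in_\<Omega>: "x \<in> \<Omega>" if "d x \<le> 5 * s" for x using that e0 s by (auto simp: d_def)
  define A where "A = {x. d x \<le> s}"
  define K where "K = {x. d x \<le> 3 * s}"
  have "cU \<subseteq> A" using s by (auto simp: A_def d_def)
  then have A: "compact A" "A \<noteq> {}" using comp[of s] s cU(2) by (auto simp: A_def)
  have K: "compact K" "K \<subseteq> \<Omega>" using comp[of "3 * s"] s in_\<Omega> by (auto simp: K_def)
  obtain \<eta> \<eta>' L where "C1_cutoff A s \<eta> \<eta>' L" using C1_cutoff_exists[OF A s(1)] by blast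
  then have
    \<eta>_dd: "\<And>b x. has_dd \<eta> (\<eta>' b x) b x" and cont_\<eta>: "continuous_on UNIV \<eta>" "\<And>b. continuous_on UNIV (\<eta>' b)"
    and \<eta>_range: "\<And>x. 0 \<le> \<eta> x" "\<And>x. \<eta> x \<le> 1"
    and \<eta>_in: "\<And>x. x \<in> A \<Longrightarrow> \<eta> x = 1" "\<And>x b. x \<in> A \<Longrightarrow> \<eta>' b x = 0"
    and \<eta>_out: "\<And>x. infdist x A \<ge> s \<Longrightarrow> \<eta> x = 0" "\<And>x b. infdist x A \<ge> s \<Longrightarrow> \<eta>' b x = 0"
    and L: "L \<ge> 0" "\<And>b x. b \<in> Basis \<Longrightarrow> \<bar>\<eta>' b x\<bar> \<le> L"
    unfolding C1_cutoff_def by blast+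
  have far: "infdist x A \<ge> s" if "d x \<ge> 2 * s" for x
  proof -
    have "s \<le> dist x a" if "a \<in> A" for a
      using d_tri[of x a] that \<open>d x \<ge> 2 * s\<close> by (simp add: A_def)
    then show ?thesis unfolding infdist_def using A(2) by (auto intro!: cINF_greatest)
  qed
  \<comment> \<open>A tent in the distance, centred at 3 s / 2: zero at distance 0 and from 3 s on,
    and at least 1 between s and 2 s, where the derivatives of \<eta> may be nonzero.\<close>
  define \<phi> where "\<phi> x = max 0 (3 / 2 - \<bar>d x - 3 / 2 * s\<bar> / s)" for x
  have cont_\<phi>: "continuous_on UNIV \<phi>"
    unfolding \<phi>_def[abs_def] using s by (intro continuous_intros cont_d) auto
  have \<phi>_zero: "\<phi> x = 0" if "d x = 0 \<or> d x \<ge> 3 * s" for x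
  proof -
    have "3 / 2 * s \<le> \<bar>d x - 3 / 2 * s\<bar>" using that s by auto
    then show ?thesis using s by (simp add: \<phi>_def le_divide_eq)
  qed
  have \<phi>_ge: "1 \<le> \<phi> x" if "s \<le> d x" "d x \<le> 2 * s" for x
  proof -
    have "\<bar>d x - 3 / 2 * s\<bar> \<le> 1 / 2 * s" using that s by linarith
    then have "\<bar>d x - 3 / 2 * s\<bar> / s \<le> 1 / 2" using s by (simp add: divide_le_eq)
    then show ?thesis by (simp add: \<phi>_def)
  qed
  have \<phi>_nonneg: "0 \<le> \<phi> x" for x by (simp add: \<phi>_def)
  have suppK: "\<eta> x = 0" "\<eta>' b x = 0" "\<phi> x = 0" if "x \<notin> K" for x b
    using that s \<eta>_out far[of x] \<phi>_zero[of x] by (auto simp: K_def)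
  have \<eta>'_le: "\<bar>\<eta>' b x\<bar> \<le> L * \<phi> x" if "b \<in> Basis" for b x
  proof (cases "s \<le> d x \<and> d x \<le> 2 * s")
    case True
    then have "L * 1 \<le> L * \<phi> x" using \<phi>_ge L by (intro mult_left_mono) auto
    then show ?thesis using L(2)[OF that, of x] by linarith
  next
    case False
    then have "\<eta>' b x = 0" using \<eta>_in(2)[of x b] \<eta>_out(2)[of x b] far[of x] by (auto simp: A_def not_le)
    then show ?thesis using L \<phi>_nonneg by simp
  qed
  obtain D where D: "D \<ge> 0" "\<And>x. x \<in> K \<Longrightarrow> norm x \<le> D"
  proof -
    obtain D0 where "\<And>x. x \<in> K \<Longrightarrow> norm x \<le> D0"
      using compact_imp_bounded[OF K(1)] by (auto simp: bounded_iff)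
    then have "norm x \<le> max D0 0" if "x \<in> K" for x using that by (simp add: le_max_iff_disj)
    then show ?thesis using that[of "max D0 0"] by simp
  qed
  \<comment> \<open>With this half side, bounding the norm by the sum of the coordinates keeps the
    cube within distance s of its centre.\<close>
  define r where "r = s / DIM('a)"
  have r: "r > 0" using s by (simp add: r_def)
  obtain B where B: "B \<ge> 0" "\<And>n x. cbox (x - r *\<^sub>R One) (x + r *\<^sub>R One) \<subseteq> \<Omega> \<Longrightarrow> norm (u n x) \<le> B"
    using solution_sup_bound[OF \<Omega>(1) V M r] eps(1) sol en by blast
  have box: "cbox (x - r *\<^sub>R One) (x + r *\<^sub>R One) \<subseteq> \<Omega>" if "d x \<le> 4 * s" for x
  proof
    fix y assume y: "y \<in> cbox (x - r *\<^sub>R One) (x + r *\<^sub>R One)"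
    have "norm (y - x) \<le> (\<Sum>b\<in>Basis. \<bar>(y - x) \<bullet> b\<bar>)" by (rule norm_le_l1)
    also have "\<dots> \<le> (\<Sum>b\<in>(Basis :: 'a set). r)"
    proof (rule sum_mono)
      fix b :: 'a assume b: "b \<in> Basis"
      have "(x - r *\<^sub>R One) \<bullet> b \<le> y \<bullet> b" "y \<bullet> b \<le> (x + r *\<^sub>R One) \<bullet> b"
        using y b by (auto simp: mem_box)
      then show "\<bar>(y - x) \<bullet> b\<bar> \<le> r" using b by (simp add: inner_simps abs_le_iff)
    qed
    also have "\<dots> = s" by (simp add: r_def)
    finally show "y \<in> \<Omega>" using d_tri[of y x] that by (intro in_\<Omega>) (simp add: dist_norm)
  qed
  have supB: "norm (u n x) \<le> B" if "d x \<le> 4 * s" for n x using B box that by blast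
  obtain P where P: "\<And>n x b. b \<in> Basis \<Longrightarrow> d x \<le> 3 * s \<Longrightarrow> norm (pd b (u n) x) \<le> P / \<epsilon> n"
  proof -
    from solution_gradient_bound[OF \<Omega>(1) V B(1) s(1)] obtain P where
      P: "\<And>\<epsilon> u x b. 0 < \<epsilon> \<and> \<epsilon> \<le> 1 \<and> solution_on \<Omega> V \<epsilon> u \<and> b \<in> Basis \<and>
        cball x s \<subseteq> \<Omega> \<and> (\<forall>y\<in>cball x s. norm (u y) \<le> B) \<longrightarrow> norm (pd b u x) \<le> P / \<epsilon>" by blast
    have "norm (pd b (u n) x) \<le> P / \<epsilon> n" if "b \<in> Basis" "d x \<le> 3 * s" for n x b
    proof -
      have dy: "d y \<le> 4 * s" if "y \<in> cball x s" for y
        using d_tri[of y x] \<open>d x \<le> 3 * s\<close> that by (simp add: dist_commute)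
      have "cball x s \<subseteq> \<Omega>" using dy in_\<Omega> s by fastforce
      then show ?thesis using P[of "\<epsilon> n" "u n" b x] dy supB eps(1) sol that by blast
    qed
    then show ?thesis using that by blast
  qed
  obtain c0 A0 where h: "c0 > 0" "A0 \<ge> 0" "\<And>y v. norm y \<le> B \<Longrightarrow>
      c0 * (norm v)\<^sup>2 \<le> v \<bullet> frechet_derivative (grad V) (at y) v + A0 * V y * (norm v)\<^sup>2"
    using hessian_lower_bound[OF V, of B] by blast
  obtain G where G: "\<And>y. norm y \<le> B \<Longrightarrow> norm (grad V y) \<le> G"
  proof -
    have "bounded (grad V ` cball 0 B)"
      using Vf(6) by (intro compact_imp_bounded compact_continuous_image) (auto intro: continuous_on_subset)
    then obtain G where "\<forall>z\<in>grad V ` cball 0 B. norm z \<le> G" unfolding bounded_iff by blast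
    then show ?thesis using that[of G] by auto
  qed
  define X where "X n = (\<integral>x. \<eta> x * energy_density V (\<epsilon> n) (u n) x \<partial>lborel)" for n
  define \<Phi> where "\<Phi> n = (\<integral>x. \<phi> x * energy_density V (\<epsilon> n) (u n) x \<partial>lborel)" for n
  define I where "I = (\<integral>x. \<phi> x \<partial>lborel)"
  \<comment> \<open>The potential estimate inserted into the gradient estimate. The factor 1 / (2
    c0) combines division by the convexity constant with the 1/2 in the gradient energy; the
    remaining factors 2 are the dimension.\<close>
  define Y where "Y n = 1 / (2 * c0) * (L * \<Phi> n + 2 * L * G\<^sup>2 * \<epsilon> n * I + 2 * A0 * P\<^sup>2 * (5 * L * D * \<Phi> n))
    + 5 * L * D * \<Phi> n" for n
  have XY: "X n \<le> Y n" for n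
  proof -
    interpret cutoff_solution \<Omega> K \<eta> \<phi> \<eta>' L D V "\<epsilon> n" "u n"
      using \<Omega>(1) K \<eta>_dd cont_\<eta> cont_\<phi> suppK \<eta>_range(1) \<phi>_nonneg L(1) \<eta>'_le D V eps(1)[of n] sol[of n]
      by unfold_locales auto
    define W where "W = (\<integral>x. \<eta> x * (1 / \<epsilon> n * V (u n x)) \<partial>lborel)"
    define Q where "Q = (\<integral>x. \<eta> x * (\<epsilon> n * grad_norm2 (u n) x) \<partial>lborel)"
    have W: "W \<le> 5 * L * D * \<Phi> n" using potential_estimate[OF dim] by (simp only: W_def \<Phi>_def)
    have "c0 * Q \<le> L * \<Phi> n + DIM('a) * L * G\<^sup>2 * \<epsilon> n * I + DIM('a) * A0 * P\<^sup>2 * W"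
      unfolding Q_def \<Phi>_def I_def W_def
    proof (rule gradient_estimate[OF h])
      show "norm (u n x) \<le> B" if "x \<in> K" for x using that s by (intro supB) (simp add: K_def)
      show "norm (grad V y) \<le> G" if "norm y \<le> B" for y using G that .
      show "norm (pd b (u n) x) \<le> P / \<epsilon> n" if "x \<in> K" "b \<in> Basis" for x b
        using P[of b x n] that by (simp add: K_def)
    qed
    moreover have "2 * A0 * P\<^sup>2 * W \<le> 2 * A0 * P\<^sup>2 * (5 * L * D * \<Phi> n)"
      using W h(2) by (intro mult_left_mono) auto
    ultimately have "c0 * Q \<le> L * \<Phi> n + 2 * L * G\<^sup>2 * \<epsilon> n * I + 2 * A0 * P\<^sup>2 * (5 * L * D * \<Phi> n)"
      unfolding dim of_nat_numeral by linarith
    then have "1 / (2 * c0) * (c0 * Q) \<le> 1 / (2 * c0) * (L * \<Phi> n + 2 * L * G\<^sup>2 * \<epsilon> n * I + 2 * A0 * P\<^sup>2 * (5 * L * D * \<Phi> n))"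
      using h(1) by (intro mult_left_mono) auto
    moreover have "1 / (2 * c0) * (c0 * Q) = 1 / 2 * Q" using h(1) by simp
    moreover have "X n = 1 / 2 * Q + W" unfolding X_def Q_def W_def by (rule energy_split)
    ultimately show ?thesis unfolding Y_def using W by linarith
  qed
  have X0: "0 \<le> X n" for n
  proof -
    have "0 \<le> energy_density V (\<epsilon> n) (u n) x" for x
      using energy_density_nonneg[where V = V] Vf(2) eps(1)[of n] by blast
    then show ?thesis
      unfolding X_def using \<eta>_range(1) by (intro Bochner_Integration.integral_nonneg mult_nonneg_nonneg)
  qed
  have test: "(\<lambda>n. \<integral>x. f x * energy_density V (\<epsilon> n) (u n) x \<partial>lborel) \<longlonglongrightarrow> (\<integral>x. f x \<partial>\<nu>)"
    if f: "continuous_on UNIV f" "\<And>x. x \<notin> K \<Longrightarrow> f x = 0" for f :: "'a \<Rightarrow> real"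
  proof -
    have sub: "closure {x. f x \<noteq> 0} \<subseteq> K"
      using f(2) K(1) by (intro closure_minimal) (auto simp: compact_imp_closed)
    then have "compact (closure {x. f x \<noteq> 0})"
      using K(1) by (meson bounded_subset closed_closure compact_eq_bounded_closed)
    then have "(\<lambda>n. \<integral>x. f x \<partial>energy_measure \<Omega> V (\<epsilon> n) (u n)) \<longlonglongrightarrow> (\<integral>x. f x \<partial>\<nu>)"
      using conv f(1) sub K(2) unfolding converges_as_measures_on_def by blast
    moreover have "(\<integral>x. f x \<partial>energy_measure \<Omega> V (\<epsilon> n) (u n))
        = (\<integral>x. f x * energy_density V (\<epsilon> n) (u n) x \<partial>lborel)" for n
      using sol[of n] eps(1)[of n] f K(2) Vf(2)
      by (intro integral_energy_measure[OF \<Omega>(1) _ Vf(5)]) (auto simp: solution_on_def)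
    ultimately show ?thesis by simp
  qed
  have sets: "sets \<nu> = sets (restrict_space borel \<Omega>)" and fin: "\<And>K. compact K \<Longrightarrow> K \<subseteq> \<Omega> \<Longrightarrow> emeasure \<nu> K < \<infinity>"
    using \<nu> by (auto simp: radon_measure_on_def)
  have compact_sets: "C \<in> sets \<nu>" if "compact C" "C \<subseteq> \<Omega>" for C
    using that \<Omega>(1) by (simp add: sets sets_restrict_space_iff borel_compact)
  \<comment> \<open>Where \<phi> is nonzero, the distance to the closure of U is positive, so the
    point is outside U, and less than 3 s, hence below \<delta>; distances to U and to its closure
    agree.\<close>
  have "(\<integral>x. \<phi> x \<partial>\<nu>) = 0"
  proof (rule integral_eq_zero_AE, rule AE_I[OF _ null(2,1)])
    show "{x \<in> space \<nu>. \<phi> x \<noteq> 0} \<subseteq> collar \<Omega> U \<delta>"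
    proof
      fix x assume "x \<in> {x \<in> space \<nu>. \<phi> x \<noteq> 0}"
      then have "\<not> (d x = 0 \<or> d x \<ge> 3 * s)" using \<phi>_zero[of x] by blast
      then have x: "d x > 0" "d x < 3 * s" using d_nonneg[of x] by linarith+
      have "x \<notin> cU" using x by (auto simp: d_def)
      then have "x \<notin> U" using cU(4) by blast
      moreover have "infdist x U = d x" by (simp add: d_def cU_def infdist_eq_setdist)
      ultimately show "x \<in> collar \<Omega> U \<delta>"
        using x s in_\<Omega>[of x] by (simp add: collar_def nbhd_def)
    qed
  qed
  then have \<Phi>_lim: "\<Phi> \<longlonglongrightarrow> 0"
    using test[OF cont_\<phi>] suppK(3) unfolding \<Phi>_def[abs_def] by simp
  have "Y \<longlonglongrightarrow> 1 / (2 * c0) * (L * 0 + 2 * L * G\<^sup>2 * 0 * I + 2 * A0 * P\<^sup>2 * (5 * L * D * 0)) + 5 * L * D * 0"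
    unfolding Y_def[abs_def] by (intro tendsto_intros \<Phi>_lim eps(2))
  then have "Y \<longlonglongrightarrow> 0" by simp
  have "X \<longlonglongrightarrow> 0"
  proof (rule tendsto_sandwich[where f = "\<lambda>_. 0" and h = Y])
    show "\<forall>\<^sub>F n in sequentially. 0 \<le> X n" "\<forall>\<^sub>F n in sequentially. X n \<le> Y n"
      using X0 XY by simp_all
  qed (use \<open>Y \<longlonglongrightarrow> 0\<close> in simp_all)
  moreover have "X \<longlonglongrightarrow> (\<integral>x. \<eta> x \<partial>\<nu>)"
    unfolding X_def[abs_def] using test[OF cont_\<eta>(1)] suppK(1) by simp
  ultimately have \<eta>0: "(\<integral>x. \<eta> x \<partial>\<nu>) = 0" using LIMSEQ_unique by blast
  have m\<eta>: "\<eta> \<in> borel_measurable \<nu>"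
    using borel_measurable_continuous_on_restrict[OF continuous_on_subset[OF cont_\<eta>(1) subset_UNIV], of \<Omega>]
      measurable_cong_sets[OF sets refl] by blast
  have "integrable \<nu> \<eta>"
    using \<eta>_range suppK(1) m\<eta>
    by (intro integrableI_bounded_set[OF compact_sets[OF K] _ fin[OF K], where B = 1]) auto
  moreover have int: "integrable \<nu> (indicator cU :: 'a \<Rightarrow> real)"
    using compact_sets[OF cU(1,3)] fin[OF cU(1,3)] by (intro integrable_real_indicator) auto
  \<comment> \<open>The cutoff is 1 on the closure, so its vanishing integral leaves no mass
    there.\<close>
  moreover have "indicator cU x \<le> \<eta> x" for x
    using \<eta>_in(1)[of x] \<eta>_range(1)[of x] s by (auto simp: A_def d_def split: split_indicator)
  ultimately have "(\<integral>x. indicator cU x \<partial>\<nu>) \<le> (0 :: real)"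
    unfolding \<eta>0[symmetric] by (intro integral_mono) auto
  moreover have "cU \<inter> space \<nu> = cU" using sets.sets_into_space[OF compact_sets[OF cU(1,3)]] by blast
  ultimately have "measure \<nu> cU \<le> 0" by simp
  then have "measure \<nu> cU = 0" using measure_nonneg[of \<nu> cU] by linarith
  moreover have "emeasure \<nu> cU \<noteq> top" using fin[OF cU(1,3)] by auto
  ultimately show ?thesis by (simp add: cU_def emeasure_eq_ennreal_measure)
qed

theorem theorem8:
  fixes \<Omega> U :: "(real ^ 2) set"
    and V :: "real ^ 'k \<Rightarrow> real"
    and \<epsilon> :: "nat \<Rightarrow> real"
    and u :: "nat \<Rightarrow> real ^ 2 \<Rightarrow> real ^ 'k"
    and \<nu> :: "(real ^ 2) measure"
    and M\<^sub>0 \<delta> :: real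
  assumes "smooth_bounded_domain \<Omega>"
    and "multiwell_potential V"
    and "M\<^sub>0 > 0"
    and "\<And>n. 0 < \<epsilon> n \<and> \<epsilon> n \<le> 1"
    and "\<epsilon> \<longlonglongrightarrow> 0"
    and "\<And>n. solution_on \<Omega> V (\<epsilon> n) (u n)"
    and "\<And>n. energy \<Omega> V (\<epsilon> n) (u n) \<le> ennreal M\<^sub>0"
    and "radon_measure_on \<Omega> \<nu>"
    and "converges_as_measures_on \<Omega> (\<lambda>n. energy_measure \<Omega> V (\<epsilon> n) (u n)) \<nu>"
    and "open U" and "closure U \<subseteq> \<Omega>"
    and "\<delta> > 0"
    and "emeasure \<nu> (collar \<Omega> U \<delta>) = 0"
  shows "emeasure \<nu> (closure U) = 0"
proof (rule limit_energy_vanishes[OF _ _ _ assms(2) _ assms(4-9) assms(11,12) _ assms(13)])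
  show "DIM(real ^ 2) = 2" by simp
  show \<Omega>: "open \<Omega>" "bounded \<Omega>" using assms(1) by (auto simp: smooth_bounded_domain_def)
  show "M\<^sub>0 \<ge> 0" using assms(3) by simp
  \<comment> \<open>\<open>emeasure\<close> is 0 by default on non-measurable sets, so measurability
    must be established before the null collar can serve as an exceptional set.\<close>
  have "closed {x. infdist x U \<le> \<delta>}" by (intro closed_Collect_le continuous_intros)
  moreover have "collar \<Omega> U \<delta> = \<Omega> \<inter> {x. infdist x U \<le> \<delta>} - U"
    by (auto simp: collar_def nbhd_def)
  ultimately have "collar \<Omega> U \<delta> \<in> sets borel" using \<Omega>(1) \<open>open U\<close> by auto
  moreover have "collar \<Omega> U \<delta> \<subseteq> \<Omega>" by (auto simp: collar_def nbhd_def)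
  ultimately show "collar \<Omega> U \<delta> \<in> sets \<nu>"
    using assms(8) \<Omega>(1) by (auto simp: radon_measure_on_def sets_restrict_space_iff)
qed

end
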